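(* If $(g,\Gamma)$ is a Gårding-like pair on a finite-dimensional real vector space $V$, then $$g^{**}=g .$$ In particular, if $g$ is a Gårding polynomial on $S(n)$ with Gårding cone $\Gamma$ whose edge $\overline\Gamma\cap(-\overline\Gamma)$ is $\{0\}$, then $$g=g^{**}\ \text{ on }\Gamma\qquad\text{and}\qquad\Gamma=\Gamma^{**}.$$
   Context: $S(n)$ is the space of real symmetric $n\times n$ matrices. A Gårding polynomial of degree $N\ge1$ on a finite-dimensional real vector space $V$ is a homogeneous real polynomial $g$ of degree $N$ on $V$ together with a connected component $\Gamma$ of $\{g>0\}$ (the Gårding cone, an open convex cone) such that for some $e\in\Gamma$ and every $v\in V$ the polynomial $t\mapsto g(te+v)$ has exactly $N$ real roots counted with multiplicity. For an open convex cone $\Gamma\subset V$, $\Gamma^0=\{y\in V^*:\langle y,x\rangle\ge0\ \forall x\in\Gamma\}$ and $\Gamma^*$ (the open polar) is the interior of $\Gamma^0$ relative to its linear span. If the edge $\overline\Gamma\cap(-\overline\Gamma)$ is $\{0\}$ then this span is $V^*$. A Gårding-like pair of degree $N\ge1$ on $V$ consists of a non-empty open convex cone $\Gamma\subset V$ and a function $g:\Gamma\to\mathbb{R}$ such that: (1) $g$ is real analytic on $\Gamma$; (2) $\log g$ is strictly concave on $\Gamma$; (3) $g$ is positively homogeneous of degree $N$; (4) $g(y+z)>g(y)$ for all $y,z\in\Gamma$; (5) $g$ extends continuously to $\overline\Gamma$ with $g=0$ on $\partial\Gamma$ and $g>0$ on $\Gamma$; (6) for each $x\in\Gamma^*$,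 the function $y\mapsto\langle x,y\rangle-\log g(y)$ is a strictly convex exhaustion function on $\Gamma$, i.e. it is strictly convex and its prelevel sets $\{\,\cdot\le c\}$ are compact for all $c\in\mathbb{R}$. (These force the edge of $\Gamma$ to be $\{0\}$.) For a Gårding polynomial with zero edge, or a Gårding-like pair, the gradient map $F(x)=D_x\log g$ is a bijection from $\Gamma$ onto $\Gamma^*$, and the dual function is defined by $g^*(y)=1/g(F^{-1}(y))$ for $y\in\Gamma^*$. The double dual $(g^{**},\Gamma^{**})$ is obtained by applying the same construction to $(g^*,\Gamma^* )$, with $V^{**}=V$; thus $\Gamma^{**}=(\Gamma^* )^*$ and $g^{**}=(g^* )^*$, defined using the gradient map $D\log g^*:\Gamma^*\to\Gamma^{**}$. *)

theory Defs
  imports "HOL-Analysis.Analysis" "HOL-Computational_Algebra.Polynomial"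
begin

section \<open>The space of real symmetric matrices\<close>

typedef ('n::finite) sym_matrix = "{A :: real^'n^'n. transpose A = A}"
  morphisms matrix_of_sym Sym_Matrix
proof
  show "mat 1 \<in> {A :: real^'n^'n. transpose A = A}" by (simp add: transpose_mat)
qed

setup_lifting type_definition_sym_matrix

lemma subspace_symmetric: "subspace {A :: real^'n^'n. transpose A = A}"
  by (auto simp: subspace_def transpose_def vec_eq_iff)

text \<open>The topology and the inner product are those inherited from the ambient space of all
  matrices, so that the inner product is the trace form. The basis is some orthonormal basis; no
  definition below depends on the choice.\<close>

instantiation sym_matrix :: (finite) real_inner
begin

lift_definition zero_sym_matrix :: "'a sym_matrix" is 0
  using subspace_symmetric by (auto simp: subspace_def)
lift_definition plus_sym_matrix :: "'a sym_matrix \<Rightarrow> 'a sym_matrix \<Rightarrow> 'a sym_matrix" is "(+)"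
  using subspace_symmetric by (auto simp: subspace_def)
lift_definition minus_sym_matrix :: "'a sym_matrix \<Rightarrow> 'a sym_matrix \<Rightarrow> 'a sym_matrix" is "(-)"
  by (auto simp: transpose_def vec_eq_iff)
lift_definition uminus_sym_matrix :: "'a sym_matrix \<Rightarrow> 'a sym_matrix" is uminus
  by (auto simp: transpose_def vec_eq_iff)
lift_definition scaleR_sym_matrix :: "real \<Rightarrow> 'a sym_matrix \<Rightarrow> 'a sym_matrix" is "(*\<^sub>R)"
  using subspace_symmetric by (auto simp: subspace_def)
lift_definition inner_sym_matrix :: "'a sym_matrix \<Rightarrow> 'a sym_matrix \<Rightarrow> real" is "(\<bullet>)" .
lift_definition norm_sym_matrix :: "'a sym_matrix \<Rightarrow> real" is norm .

definition dist_sym_matrix :: "'a sym_matrix \<Rightarrow> 'a sym_matrix \<Rightarrow> real"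
  where "dist_sym_matrix A B = norm (A - B)"
definition sgn_sym_matrix :: "'a sym_matrix \<Rightarrow> 'a sym_matrix"
  where "sgn_sym_matrix A = inverse (norm A) *\<^sub>R A"
definition [code del]: "(uniformity :: ('a sym_matrix \<times> 'a sym_matrix) filter) =
  (INF e\<in>{0<..}. principal {(A, B). dist A B < e})"
definition open_sym_matrix :: "'a sym_matrix set \<Rightarrow> bool"
  where [code del]: "open_sym_matrix S \<longleftrightarrow>
    (\<forall>A\<in>S. \<forall>\<^sub>F (A', B) in uniformity. A' = A \<longrightarrow> B \<in> S)"

instance
proof
  fix A B C :: "'a sym_matrix" and r s :: real
  show "A + B + C = A + (B + C)" by transfer simp
  show "A + B = B + A" by transfer simp
  show "0 + A = A" by transfer simp
  show "- A + A = 0" by transfer simp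
  show "A - B = A + - B" by transfer simp
  show "r *\<^sub>R (A + B) = r *\<^sub>R A + r *\<^sub>R B" by transfer (simp add: scaleR_right_distrib)
  show "(r + s) *\<^sub>R A = r *\<^sub>R A + s *\<^sub>R A" by transfer (simp add: scaleR_left_distrib)
  show "r *\<^sub>R s *\<^sub>R A = (r * s) *\<^sub>R A" by transfer simp
  show "1 *\<^sub>R A = A" by transfer simp
  show "dist A B = norm (A - B)" by (rule dist_sym_matrix_def)
  show "sgn A = inverse (norm A) *\<^sub>R A" by (rule sgn_sym_matrix_def)
  show "(uniformity :: ('a sym_matrix \<times> 'a sym_matrix) filter) =
    (INF e\<in>{0<..}. principal {(A, B). dist A B < e})" by (rule uniformity_sym_matrix_def)
  show "open S \<longleftrightarrow> (\<forall>A\<in>S. \<forall>\<^sub>F (A', B) in uniformity. A' = A \<longrightarrow> B \<in> S)"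
    for S :: "'a sym_matrix set" by (rule open_sym_matrix_def)
  show "A \<bullet> B = B \<bullet> A" by transfer (rule inner_commute)
  show "(A + B) \<bullet> C = A \<bullet> C + B \<bullet> C" by transfer (rule inner_add_left)
  show "r *\<^sub>R A \<bullet> B = r * (A \<bullet> B)" by transfer simp
  show "0 \<le> A \<bullet> A" by transfer simp
  show "A \<bullet> A = 0 \<longleftrightarrow> A = 0" by transfer simp
  show "norm A = sqrt (A \<bullet> A)" by transfer (rule norm_eq_sqrt_inner)
qed

end

instantiation sym_matrix :: (finite) euclidean_space
begin

definition Basis_sym_matrix :: "'a sym_matrix set" where
  "Basis_sym_matrix = (SOME B. finite B \<and> (\<forall>u\<in>B. \<forall>v\<in>B. u \<bullet> v = (if u = v then 1 else 0)) \<and>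
     span B = UNIV)"

instance
proof
  let ?S = "{A :: real^'a^'a. transpose A = A}"
  have "\<exists>B :: 'a sym_matrix set. finite B \<and>
     (\<forall>u\<in>B. \<forall>v\<in>B. u \<bullet> v = (if u = v then 1 else 0)) \<and> span B = UNIV"
  proof -
    obtain B where B: "B \<subseteq> ?S" "pairwise orthogonal B" "\<And>x. x \<in> B \<Longrightarrow> norm x = 1"
      "independent B" "span B = ?S"
      by (rule orthonormal_basis_subspace[OF subspace_symmetric]) blast
    have fin: "finite B" using B(4) independent_imp_finite by blast
    have rep: "matrix_of_sym (Sym_Matrix x) = x" if "x \<in> B" for x
      using that B(1) by (auto intro: Sym_Matrix_inverse)
    have lin: "linear (matrix_of_sym :: 'a sym_matrix \<Rightarrow> _)"
      by (rule linearI) (simp_all add: plus_sym_matrix.rep_eq scaleR_sym_matrix.rep_eq)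
    have im: "matrix_of_sym ` Sym_Matrix ` B = B"
      by (simp add: image_image rep cong: image_cong)
    have "span (Sym_Matrix ` B) = UNIV"
    proof -
      have "matrix_of_sym ` span (Sym_Matrix ` B) = ?S"
        using linear_span_image[OF lin, of "Sym_Matrix ` B"] im B(5) by simp
      then have "A \<in> span (Sym_Matrix ` B)" for A :: "'a sym_matrix"
        proof -
        have "matrix_of_sym A \<in> matrix_of_sym ` span (Sym_Matrix ` B)"
          using \<open>matrix_of_sym ` span (Sym_Matrix ` B) = ?S\<close> matrix_of_sym[of A] by blast
        then show ?thesis by (auto simp: matrix_of_sym_inject)
      qed
      then show ?thesis by blast
    qed
    moreover have "u \<bullet> v = (if u = v then 1 else 0)"
      if "u \<in> Sym_Matrix ` B" "v \<in> Sym_Matrix ` B" for u v :: "'a sym_matrix"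
      using that B(2) B(3) rep
      by (auto simp: inner_sym_matrix.rep_eq pairwise_def orthogonal_def norm_eq_1) metis
    ultimately show ?thesis using fin by (intro exI[of _ "Sym_Matrix ` B"]) auto
  qed
  then have *: "finite (Basis :: 'a sym_matrix set) \<and>
     (\<forall>u\<in>Basis. \<forall>v\<in>Basis. (u :: 'a sym_matrix) \<bullet> v = (if u = v then 1 else 0)) \<and>
     span (Basis :: 'a sym_matrix set) = UNIV"
    unfolding Basis_sym_matrix_def by (rule someI_ex)
  show "finite (Basis :: 'a sym_matrix set)" using * by blast
  show "u \<bullet> v = (if u = v then 1 else 0)" if "u \<in> Basis" "v \<in> Basis" for u v :: "'a sym_matrix"
    using * that by blast
  show "(\<forall>u\<in>Basis. x \<bullet> u = 0) \<longleftrightarrow> x = 0" for x :: "'a sym_matrix"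
  proof
    assume "\<forall>u\<in>Basis. x \<bullet> u = 0"
    then have "\<And>u. u \<in> Basis \<Longrightarrow> orthogonal x u" by (simp add: orthogonal_def)
    moreover have "x \<in> span Basis" using * by blast
    ultimately have "orthogonal x x" using orthogonal_to_span by blast
    then show "x = 0" by (simp add: orthogonal_def)
  qed simp
  show "(Basis :: 'a sym_matrix set) \<noteq> {}"
  proof
    assume "(Basis :: 'a sym_matrix set) = {}"
    then have "Sym_Matrix (mat 1) = (0 :: 'a sym_matrix)" using * by auto
    then have "(mat 1 :: real^'a^'a) = 0"
      using Sym_Matrix_inverse[of "mat 1 :: real^'a^'a"]
      by (simp add: transpose_mat zero_sym_matrix.rep_eq)
    then show False by (simp add: mat_def vec_eq_iff) (metis zero_neq_one)
  qed
qed

end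


section \<open>Garding polynomials\<close>

definition edge :: "'a::real_normed_vector set \<Rightarrow> 'a set" where
  "edge \<Gamma> = closure \<Gamma> \<inter> uminus ` closure \<Gamma>"

text \<open>That the Garding cone is open and convex is a consequence of the definition and is
  not assumed.\<close>

definition garding_polynomial :: "nat \<Rightarrow> ('a::euclidean_space \<Rightarrow> real) \<Rightarrow> 'a set \<Rightarrow> bool" where
  "garding_polynomial N g \<Gamma> \<longleftrightarrow>
     N \<ge> 1 \<and>
     real_polynomial_function g \<and>
     (\<forall>t x. g (t *\<^sub>R x) = t ^ N * g x) \<and>
     \<Gamma> \<in> components {x. g x > 0} \<and>
     (\<exists>e\<in>\<Gamma>. \<forall>v. \<exists>p :: real poly.
        (\<forall>t. poly p t = g (t *\<^sub>R e + v)) \<and> p \<noteq> 0 \<and> size (proots p) = N)"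


section \<open>Duality\<close>

text \<open>The dual of a space \<open>'a\<close> is the type \<open>'a \<Rightarrow>\<^sub>L real\<close>. The definitions are made over
  normed spaces so that they apply to a space, to its dual and to its double dual.\<close>

definition polar :: "'a::real_normed_vector set \<Rightarrow> ('a \<Rightarrow>\<^sub>L real) set" where
  "polar \<Gamma> = {y. \<forall>x\<in>\<Gamma>. blinfun_apply y x \<ge> 0}"

definition open_polar :: "'a::real_normed_vector set \<Rightarrow> ('a \<Rightarrow>\<^sub>L real) set" where
  "open_polar \<Gamma> = (top_of_set (span (polar \<Gamma>))) interior_of (polar \<Gamma>)"

text \<open>The derivative of \<open>log g\<close>. At a point of an open set \<open>\<Gamma>\<close> it depends only on the values of
  \<open>g\<close> on \<open>\<Gamma>\<close>, so \<open>g\<close> may have arbitrary values elsewhere.\<close>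

definition log_gradient :: "('a::real_normed_vector \<Rightarrow> real) \<Rightarrow> 'a \<Rightarrow> ('a \<Rightarrow>\<^sub>L real)" where
  "log_gradient g x = Blinfun (frechet_derivative (\<lambda>z. ln (g z)) (at x))"

definition dual_function ::
    "('a::real_normed_vector \<Rightarrow> real) \<Rightarrow> 'a set \<Rightarrow> ('a \<Rightarrow>\<^sub>L real) \<Rightarrow> real" where
  "dual_function g \<Gamma> y = 1 / g (the_inv_into \<Gamma> (log_gradient g) y)"

text \<open>The canonical map of a space into its double dual.\<close>

lift_definition to_bidual :: "'a::real_normed_vector \<Rightarrow> (('a \<Rightarrow>\<^sub>L real) \<Rightarrow>\<^sub>L real)"
  is "\<lambda>x y. blinfun_apply y x"
  by (rule bounded_bilinear.bounded_linear_left[OF bounded_bilinear_blinfun_apply])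


section \<open>Garding-like pairs\<close>

text \<open>Local expansion into an absolutely convergent power series; the multi-indices are the
  functions from the basis to the natural numbers.\<close>

definition real_analytic_on :: "('a::euclidean_space \<Rightarrow> real) \<Rightarrow> 'a set \<Rightarrow> bool" where
  "real_analytic_on f S \<longleftrightarrow>
     (\<forall>x\<in>S. \<exists>r>0. \<exists>a :: ('a \<Rightarrow> nat) \<Rightarrow> real. \<forall>y\<in>ball x r.
        ((\<lambda>\<alpha>. a \<alpha> * (\<Prod>b\<in>Basis. ((y - x) \<bullet> b) ^ \<alpha> b)) has_sum f y) (Basis \<rightarrow>\<^sub>E UNIV))"

definition strictly_convex_on :: "'a::real_vector set \<Rightarrow> ('a \<Rightarrow> real) \<Rightarrow> bool" where
  "strictly_convex_on S f \<longleftrightarrow> convex S \<and>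
     (\<forall>x\<in>S. \<forall>y\<in>S. \<forall>t. x \<noteq> y \<longrightarrow> 0 < t \<longrightarrow> t < 1 \<longrightarrow>
        f ((1 - t) *\<^sub>R x + t *\<^sub>R y) < (1 - t) * f x + t * f y)"

definition strictly_concave_on :: "'a::real_vector set \<Rightarrow> ('a \<Rightarrow> real) \<Rightarrow> bool" where
  "strictly_concave_on S f \<longleftrightarrow> strictly_convex_on S (\<lambda>x. - f x)"

text \<open>The library's \<open>cone\<close> and \<open>conic\<close> also ask for scaling by \<open>0\<close>, which an open cone
  other than the whole space does not allow.\<close>

definition open_convex_cone :: "'a::real_normed_vector set \<Rightarrow> bool" where
  "open_convex_cone \<Gamma> \<longleftrightarrow> open \<Gamma> \<and> convex \<Gamma> \<and> (\<forall>x\<in>\<Gamma>. \<forall>t>0. t *\<^sub>R x \<in> \<Gamma>)"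

definition garding_like_pair :: "real \<Rightarrow> ('a::euclidean_space \<Rightarrow> real) \<Rightarrow> 'a set \<Rightarrow> bool" where
  "garding_like_pair N g \<Gamma> \<longleftrightarrow>
     N \<ge> 1 \<and> \<Gamma> \<noteq> {} \<and> open_convex_cone \<Gamma> \<and>
     real_analytic_on g \<Gamma> \<and>
     strictly_concave_on \<Gamma> (\<lambda>x. ln (g x)) \<and>
     (\<forall>x\<in>\<Gamma>. \<forall>t>0. g (t *\<^sub>R x) = t powr N * g x) \<and>
     (\<forall>y\<in>\<Gamma>. \<forall>z\<in>\<Gamma>. g (y + z) > g y) \<and>
     (\<exists>h. continuous_on (closure \<Gamma>) h \<and> (\<forall>x\<in>\<Gamma>. h x = g x) \<and> (\<forall>x\<in>frontier \<Gamma>. h x = 0)) \<and>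
     (\<forall>x\<in>\<Gamma>. g x > 0) \<and>
     (\<forall>x\<in>open_polar \<Gamma>.
        strictly_convex_on \<Gamma> (\<lambda>y. blinfun_apply x y - ln (g y)) \<and>
        (\<forall>c. compact {y \<in> \<Gamma>. blinfun_apply x y - ln (g y) \<le> c}))"

end

theory Submission
  imports Defs "HOL-Computational_Algebra.Fundamental_Theorem_Algebra"
begin

text \<open>
  Write \<open>L = log g\<close> and \<open>F = DL\<close>. The dual function is a Legendre transform in disguise. A strictly
  concave differentiable \<open>L\<close> satisfies \<open>F x = y\<close> exactly when \<open>x\<close> minimises
  \<open>z \<mapsto> \<langle>y, z\<rangle> - L z\<close> over \<open>\<Gamma>\<close>; homogeneity gives \<open>\<langle>F x, x\<rangle> = N\<close>, so the minimum is
  \<open>N - L x = N + log (g\<^sup>* (F x))\<close>. Hence \<open>log g\<^sup>*\<close> is, up to the constant \<open>N\<close>, the concave conjugate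
  of \<open>L\<close>, and the envelope theorem says that its derivative at \<open>F x\<close> is evaluation at the minimiser
  \<open>x\<close>. The gradient map of the dual pair is therefore the inverse of \<open>F\<close>, and taking reciprocals of
  values twice returns \<open>g\<close>. The lemmas carrying this are \<open>tangent_le\<close>, \<open>gradient_locally_open\<close>
  (the minimiser depends continuously on \<open>y\<close>), \<open>gradient_image\<close> (compact sublevel sets supply
  minimisers), \<open>log_dual_difference\<close> and \<open>log_gradient_dual\<close>. The statement on cones is the bipolar
  theorem, with interiors taken at both stages (\<open>open_bipolar\<close>).

  For a Garding-like pair the hypotheses of this argument are part of the definition, apart from
  differentiability, which comes from the power series
  (\<open>real_analytic_imp_differentiable\<close>).

  For a Garding polynomial they are consequences of hyperbolicity. The
  polynomial is extended to complex vectors, and a direction \<open>a\<close> is called hyperbolic if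
  \<open>g (v + z a) \<noteq> 0\<close> for all real \<open>v\<close> and nonreal \<open>z\<close>. If \<open>e \<in> \<Gamma>\<close> is hyperbolic, then \<open>\<Gamma>\<close> is starlike
  about \<open>e\<close> (\<open>component_subset_ray_cone\<close>). The heart of the matter is that hyperbolicity spreads from
  one point to all of \<open>\<Gamma>\<close> (\<open>ray_cone_hyperbolic\<close>): the roots \<open>s\<close> of \<open>g (v + \<i> \<mu> e + s a)\<close> stay in the
  lower half plane as \<open>\<mu>\<close> runs from infinity to \<open>0\<close>, because for \<open>\<mu> > 0\<close> they cannot cross the real
  axis. So \<open>\<Gamma>\<close> is starlike about each of its points, that is, convex, and along a
  segment from \<open>x\<close> in the direction \<open>v\<close> one has \<open>g (x + t v) = g x \<Prod>(1 - t l\<^sub>i)\<close> with real \<open>l\<^sub>i\<close>. Each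
  \<open>log (1 - t l\<^sub>i)\<close> is concave, strictly unless \<open>l\<^sub>i = 0\<close>; if all \<open>l\<^sub>i\<close> vanish then \<open>v\<close> lies in the edge.
  Compactness of sublevel sets holds since \<open>g\<close> grows polynomially and \<open>exp \<langle>y, x\<rangle>\<close> exponentially.
\<close>

section \<open>Polar cones and the double dual space\<close>

text \<open>Applied along segments issuing from a point of a cone, where the function is controlled on
  one side only.\<close>
lemma deriv_at_right_minimum_nonneg:
  fixes \<phi> :: "real \<Rightarrow> real"
  assumes "(\<phi> has_real_derivative D) (at 0)" "\<And>t. 0 < t \<Longrightarrow> t < 1 \<Longrightarrow> \<phi> 0 \<le> \<phi> t"
  shows "D \<ge> 0"
proof (rule ccontr)
  assume "\<not> D \<ge> 0"
  then obtain d where d: "d > 0" "\<And>h. 0 < h \<Longrightarrow> h < d \<Longrightarrow> \<phi> 0 > \<phi> h"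
    using DERIV_neg_dec_right[OF assms(1)] by auto
  have "\<phi> 0 > \<phi> (min (d/2) (1/2))" using d by simp
  moreover have "\<phi> 0 \<le> \<phi> (min (d/2) (1/2))" using d(1) by (intro assms(2)) auto
  ultimately show False by simp
qed

lemma has_real_derivative_along_line:
  assumes "(f has_derivative blinfun_apply A) (at x)"
  shows "((\<lambda>t. f (x + t *\<^sub>R v)) has_real_derivative blinfun_apply A v) (at 0)"
proof -
  have 1: "((\<lambda>t. x + t *\<^sub>R v) has_derivative (\<lambda>t. t *\<^sub>R v)) (at (0::real))"
    by (auto intro!: derivative_eq_intros)
  have 2: "(f has_derivative blinfun_apply A) (at (x + 0 *\<^sub>R v))" using assms by simp
  have "((\<lambda>t. f (x + t *\<^sub>R v)) has_derivative (\<lambda>t. blinfun_apply A (t *\<^sub>R v))) (at 0)"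
    using diff_chain_at[OF 1 2] by (simp add: o_def)
  then show ?thesis
    by (simp add: has_field_derivative_def blinfun.scaleR_right mult_commute_abs)
qed

lemma log_gradient_eqI:
  assumes "((\<lambda>z. ln (g z)) has_derivative blinfun_apply A) (at x)"
  shows "log_gradient g x = A"
  by (simp add: log_gradient_def blinfun_apply_inverse flip: frechet_derivative_at[OF assms])

lemma span_superset_of_open:
  fixes S :: "'a::real_normed_vector set"
  assumes "interior S \<noteq> {}"
  shows "span S = UNIV"
proof -
  obtain y e where y: "e > 0" "ball y e \<subseteq> S"
    using assms by (metis equals0I mem_interior)
  have "v \<in> span S" for v
  proof (cases "v = 0")
    case False
    define c where "c = e / (2 * norm v)"
    have "c > 0" using False y(1) by (simp add: c_def)
    have "norm (c *\<^sub>R v) < e" using False y(1) by (simp add: c_def)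
    then have "y + c *\<^sub>R v \<in> ball y e" "y \<in> ball y e" using y(1) by (auto simp: dist_norm)
    then have "(y + c *\<^sub>R v) - y \<in> span S" using y(2) by (intro span_diff span_base) auto
    then have "c *\<^sub>R v \<in> span S" by simp
    then have "(1/c) *\<^sub>R (c *\<^sub>R v) \<in> span S" by (rule span_scale)
    moreover have "(1/c) *\<^sub>R (c *\<^sub>R v) = v" using \<open>c > 0\<close> by simp
    ultimately show ?thesis by metis
  qed (simp add: span_zero)
  then show ?thesis by auto
qed

text \<open>A set with interior spans the whole space, so the relative interior in the definition of the
  open polar is an ordinary interior.\<close>
lemma open_polar_eq_interior:
  assumes "interior (polar \<Gamma>) \<noteq> {}"
  shows "open_polar \<Gamma> = interior (polar \<Gamma>)"
  unfolding open_polar_def span_superset_of_open[OF assms]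
  by simp

lemma to_bidual_apply [simp]: "blinfun_apply (to_bidual x) y = blinfun_apply y x"
  by transfer simp

text \<open>The inverse of \<open>to_bidual\<close>, by which finite dimension enters: an element of the
  double dual is determined by its values on the coordinate functionals, which are the inner products
  with the basis vectors.\<close>
definition from_bidual :: "(('a::euclidean_space \<Rightarrow>\<^sub>L real) \<Rightarrow>\<^sub>L real) \<Rightarrow> 'a" where
  "from_bidual \<xi> = (\<Sum>b\<in>Basis. blinfun_apply \<xi> (blinfun_inner_left b) *\<^sub>R b)"

lemma functional_eq_inner:
  fixes y :: "'a::euclidean_space \<Rightarrow>\<^sub>L real"
  shows "y = blinfun_inner_left (\<Sum>b\<in>Basis. blinfun_apply y b *\<^sub>R b)"
proof (rule blinfun_eqI)
  fix x
  have "blinfun_apply y x = blinfun_apply y (\<Sum>b\<in>Basis. (x \<bullet> b) *\<^sub>R b)"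
    by (simp add: euclidean_representation)
  then show "blinfun_apply y x = blinfun_apply (blinfun_inner_left (\<Sum>b\<in>Basis. blinfun_apply y b *\<^sub>R b)) x"
    by (simp add: blinfun.sum_right blinfun.scaleR_right inner_sum_right mult.commute)
qed

lemma from_to_bidual [simp]: "from_bidual (to_bidual x) = x"
  by (simp add: from_bidual_def euclidean_representation)

lemma to_bidual_eq_iff [simp]: "to_bidual x = to_bidual z \<longleftrightarrow> x = (z :: 'a::euclidean_space)"
  by (metis from_to_bidual)

lemma to_from_bidual [simp]: "to_bidual (from_bidual \<xi>) = \<xi>"
proof (rule blinfun_eqI)
  fix y :: "'a \<Rightarrow>\<^sub>L real"
  define v where "v = (\<Sum>b\<in>Basis. blinfun_apply y b *\<^sub>R b)"
  have y: "y = blinfun_inner_left v" unfolding v_def by (rule functional_eq_inner)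
  interpret bl: bounded_linear "blinfun_inner_left :: 'a \<Rightarrow> _" by (rule bounded_linear_blinfun_inner_left)
  have "blinfun_apply \<xi> y = blinfun_apply \<xi> (blinfun_inner_left (\<Sum>b\<in>Basis. (v \<bullet> b) *\<^sub>R b))"
    by (simp add: y euclidean_representation)
  also have "\<dots> = (\<Sum>b\<in>Basis. (v \<bullet> b) * blinfun_apply \<xi> (blinfun_inner_left b))"
    by (simp add: bl.sum bl.scaleR blinfun.sum_right blinfun.scaleR_right)
  finally show "blinfun_apply (to_bidual (from_bidual \<xi>)) y = blinfun_apply \<xi> y"
    by (simp add: y from_bidual_def inner_sum_left inner_sum_right mult.commute inner_commute)
qed

text \<open>Both \<open>to_bidual\<close> and its inverse are continuous, so interiors
  correspond.\<close>
lemma interior_to_bidual_image: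
  fixes C :: "'a::euclidean_space set"
  shows "interior (to_bidual ` C) = to_bidual ` interior C"
proof -
  have cont1: "continuous_on UNIV (from_bidual :: _ \<Rightarrow> 'a)"
    unfolding from_bidual_def by (intro continuous_intros)
  have cont2: "continuous_on UNIV (to_bidual :: 'a \<Rightarrow> _)"
  proof -
    have "bounded_linear (to_bidual :: 'a \<Rightarrow> _)"
    proof (rule bounded_linear_intro[where K = 1])
      show "norm (to_bidual x) \<le> norm x * 1" for x :: 'a
        
      proof (rule norm_blinfun_bound)
        show "norm (blinfun_apply (to_bidual x) y) \<le> norm x * 1 * norm y" for y
          using norm_blinfun[of y x] by (simp add: ac_simps)
      qed simp
    qed (auto intro!: blinfun_eqI simp: blinfun.bilinear_simps)
    then show ?thesis by (rule linear_continuous_on)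
  qed
  have im: "to_bidual ` S = from_bidual -` S" for S :: "'a set"
  proof (intro set_eqI iffI)
    fix \<xi> assume "\<xi> \<in> from_bidual -` S"
    then show "\<xi> \<in> to_bidual ` S" by (intro image_eqI[of \<xi> to_bidual "from_bidual \<xi>"]) auto
  qed auto
  show ?thesis
  proof
    have "open (to_bidual -` interior (to_bidual ` C))"
      by (rule open_vimage[OF open_interior cont2])
    moreover have "to_bidual -` interior (to_bidual ` C) \<subseteq> C"
    proof
      fix x :: 'a assume "x \<in> to_bidual -` interior (to_bidual ` C)"
      then have "to_bidual x \<in> to_bidual ` C" using interior_subset by blast
      then show "x \<in> C" by auto
    qed
    ultimately have "to_bidual -` interior (to_bidual ` C) \<subseteq> interior C"
      by (rule interior_maximal[rotated])
    then show "interior (to_bidual ` C) \<subseteq> to_bidual ` interior C"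
      unfolding im[of "interior C"] by (auto simp: subset_iff)
    have "open (to_bidual ` interior C)" unfolding im by (rule open_vimage[OF open_interior cont1])
    then show "to_bidual ` interior C \<subseteq> interior (to_bidual ` C)"
      by (intro interior_maximal image_mono interior_subset)
  qed
qed

lemma polar_convex_cone:
  assumes "y \<in> polar \<Gamma>" "z \<in> polar \<Gamma>" "s \<ge> 0" "t \<ge> 0"
  shows "s *\<^sub>R y + t *\<^sub>R z \<in> polar \<Gamma>"
  using assms by (auto simp: polar_def blinfun.bilinear_simps)

text \<open>The translate by \<open>y\<close> of the open set \<open>t interior (polar \<Gamma>)\<close>
  is open and stays in the polar. It lets a boundary element of the polar be approximated from the
  interior.\<close>
lemma interior_polar_add:
  assumes "y \<in> polar \<Gamma>" "z \<in> interior (polar \<Gamma>)" "t > 0"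
  shows "y + t *\<^sub>R z \<in> interior (polar \<Gamma>)"
proof -
  have "open ((+) y ` ((*\<^sub>R) t ` interior (polar \<Gamma>)))"
    using assms(3) by (intro open_translation open_scaling) auto
  moreover have "(+) y ` ((*\<^sub>R) t ` interior (polar \<Gamma>)) \<subseteq> polar \<Gamma>"
  proof -
    have "y + t *\<^sub>R w \<in> polar \<Gamma>" if "w \<in> interior (polar \<Gamma>)" for w
      using polar_convex_cone[OF assms(1) subsetD[OF interior_subset that], of 1 t] assms(3) by simp
    then show ?thesis by auto
  qed
  ultimately have "(+) y ` ((*\<^sub>R) t ` interior (polar \<Gamma>)) \<subseteq> interior (polar \<Gamma>)"
    by (rule interior_maximal[rotated])
  then show ?thesis using assms(2) by auto
qed

text \<open>Nonnegativity of \<open>\<xi>\<close> on the interior of the polar extends to the whole polar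
  by approximation from inside, and then a separating hyperplane puts the corresponding vector into the
  closure of the cone. Since an open convex set is the interior of its closure, passing to the interior
  recovers the cone itself.\<close>
lemma open_bipolar:
  fixes \<Gamma> :: "'a::euclidean_space set"
  assumes cone: "open_convex_cone \<Gamma>" and ne: "\<Gamma> \<noteq> {}" and int: "interior (polar \<Gamma>) \<noteq> {}"
  shows "open_polar (open_polar \<Gamma>) = to_bidual ` \<Gamma>"
proof -
  have op: "open \<Gamma>" "convex \<Gamma>" and scale: "\<And>x t. x \<in> \<Gamma> \<Longrightarrow> t > 0 \<Longrightarrow> t *\<^sub>R x \<in> \<Gamma>"
    using cone by (auto simp: open_convex_cone_def)
  have eq: "open_polar \<Gamma> = interior (polar \<Gamma>)" by (rule open_polar_eq_interior[OF int])
  have "polar (open_polar \<Gamma>) = to_bidual ` closure \<Gamma>"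
  proof (intro subset_antisym subsetI)
    fix \<xi> assume \<xi>: "\<xi> \<in> polar (open_polar \<Gamma>)"
    define x where "x = from_bidual \<xi>"
    have pos: "blinfun_apply y x \<ge> 0" if "y \<in> interior (polar \<Gamma>)" for y
    proof -
      have "blinfun_apply \<xi> y \<ge> 0" using \<xi> that unfolding eq by (simp add: polar_def[of "interior _"])
      then show ?thesis using to_bidual_apply[of "from_bidual \<xi>" y] unfolding x_def to_from_bidual by simp
    qed
    obtain z where z: "z \<in> interior (polar \<Gamma>)" using int by blast
    have pos': "blinfun_apply y x \<ge> 0" if "y \<in> polar \<Gamma>" for y
    proof -
      have "0 \<le> blinfun_apply y x + t * blinfun_apply z x" if "t > 0" for t
        using pos[OF interior_polar_add[OF \<open>y \<in> polar \<Gamma>\<close> z that]] by (simp add: blinfun.bilinear_simps)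
      then have ev: "eventually (\<lambda>t. 0 \<le> blinfun_apply y x + t * blinfun_apply z x) (at_right 0)"
        using eventually_at_right_less[of "0::real"] by (rule eventually_mono[rotated])
      have "((\<lambda>t. blinfun_apply y x + t * blinfun_apply z x) \<longlongrightarrow> blinfun_apply y x + 0 * blinfun_apply z x) (at_right 0)"
        by (intro tendsto_intros)
      then have "blinfun_apply y x + 0 * blinfun_apply z x \<ge> 0"
        by (rule tendsto_lowerbound[OF _ ev]) simp
      then show ?thesis by simp
    qed
    have "x \<in> closure \<Gamma>"
    proof (rule ccontr)
      assume "x \<notin> closure \<Gamma>"
      then obtain a b where ab: "a \<bullet> x < b" "\<And>w. w \<in> closure \<Gamma> \<Longrightarrow> a \<bullet> w > b"
        using separating_hyperplane_closed_point[of "closure \<Gamma>" x] convex_closure[OF op(2)] by blast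
      \<comment> \<open>A linear function bounded below on a cone is nonnegative on it, and its infimum is 0.\<close>
      have nonneg: "a \<bullet> w \<ge> 0" if "w \<in> \<Gamma>" for w
      proof (rule ccontr)
        assume "\<not> a \<bullet> w \<ge> 0"
        then have neg: "a \<bullet> w < 0" by simp
        define t where "t = (\<bar>b\<bar> + 1) / (- (a \<bullet> w))"
        have "t > 0" unfolding t_def by (rule divide_pos_pos) (use neg in auto)
        then have "t *\<^sub>R w \<in> closure \<Gamma>" using scale[OF that] closure_subset by blast
        then have "t * (a \<bullet> w) > b" using ab(2)[of "t *\<^sub>R w"] by simp
        moreover have "t * (a \<bullet> w) = - (\<bar>b\<bar> + 1)" using neg by (simp add: t_def field_simps)
        ultimately show False by linarith
      qed
      obtain w where w: "w \<in> \<Gamma>" using ne by blast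
      have "b \<le> 0"
      proof (rule ccontr)
        assume "\<not> b \<le> 0"
        then have "b > 0" by simp
        have "a \<bullet> w > b" using ab(2) w closure_subset by blast
        define t where "t = b / (2 * (a \<bullet> w))"
        have "t > 0" using \<open>b > 0\<close> \<open>a \<bullet> w > b\<close> by (simp add: t_def)
        then have "t *\<^sub>R w \<in> closure \<Gamma>" using scale[OF w] closure_subset by blast
        then have "t * (a \<bullet> w) > b" using ab(2)[of "t *\<^sub>R w"] by simp
        then show False using \<open>b > 0\<close> \<open>a \<bullet> w > b\<close> by (simp add: t_def)
      qed
      have "blinfun_inner_left a \<in> polar \<Gamma>" using nonneg by (auto simp: polar_def inner_commute)
      then have "a \<bullet> x \<ge> 0" using pos'[of "blinfun_inner_left a"] by (simp add: inner_commute)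
      then show False using ab(1) \<open>b \<le> 0\<close> by simp
    qed
    then show "\<xi> \<in> to_bidual ` closure \<Gamma>" unfolding x_def by (metis imageI to_from_bidual)
  next
    fix \<xi> :: "('a \<Rightarrow>\<^sub>L real) \<Rightarrow>\<^sub>L real" assume "\<xi> \<in> to_bidual ` closure \<Gamma>"
    then obtain x where x: "\<xi> = to_bidual x" "x \<in> closure \<Gamma>" by blast
    have "blinfun_apply y x \<ge> 0" if "y \<in> polar \<Gamma>" for y
    proof -
      have "closure \<Gamma> \<subseteq> {x. blinfun_apply y x \<ge> 0}"
      proof (rule closure_minimal)
        show "closed {x. 0 \<le> blinfun_apply y x}" by (intro closed_Collect_le continuous_intros)
      qed (use that in \<open>auto simp: polar_def\<close>)
      then show ?thesis using x(2) by blast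
    qed
    then show "\<xi> \<in> polar (open_polar \<Gamma>)"
      using interior_subset[of "polar \<Gamma>"] by (auto simp: polar_def[of "interior _"] eq x(1))
  qed
  then have "interior (polar (open_polar \<Gamma>)) = to_bidual ` \<Gamma>"
    by (simp only: interior_to_bidual_image convex_interior_closure[OF op(2)] interior_open[OF op(1)])
  then show ?thesis using ne open_polar_eq_interior[of "open_polar \<Gamma>"] by (metis image_is_empty)
qed

section \<open>Legendre duality for log-concave functions on a cone\<close>

text \<open>What the Legendre transform uses of a pair, apart from the existence of minimisers. The
  latter is separated from the rest because, for polynomials, proving it requires that the open polar be
  the interior of the polar, which is established from these conditions.\<close>
locale log_concave_cone =
  fixes g :: "'a::euclidean_space \<Rightarrow> real" and \<Gamma> :: "'a set" and N :: real
  assumes nonempty: "\<Gamma> \<noteq> {}"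
    and cone: "open_convex_cone \<Gamma>"
    and pos: "x \<in> \<Gamma> \<Longrightarrow> g x > 0"
    and diff: "x \<in> \<Gamma> \<Longrightarrow> g differentiable (at x)"
    and concave: "strictly_concave_on \<Gamma> (\<lambda>x. ln (g x))"
    and homog: "x \<in> \<Gamma> \<Longrightarrow> t > 0 \<Longrightarrow> g (t *\<^sub>R x) = t powr N * g x"
    and mono: "x \<in> \<Gamma> \<Longrightarrow> z \<in> \<Gamma> \<Longrightarrow> g x \<le> g (x + z)"
begin

abbreviation "L \<equiv> \<lambda>x. ln (g x)"
abbreviation "F \<equiv> log_gradient g"

lemma open_cone: "open \<Gamma>" and convex_cone: "convex \<Gamma>"
  and scale: "x \<in> \<Gamma> \<Longrightarrow> t > 0 \<Longrightarrow> t *\<^sub>R x \<in> \<Gamma>"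
  using cone by (auto simp: open_convex_cone_def)

lemma has_derivative_log: 
  assumes "x \<in> \<Gamma>"
  shows "(L has_derivative blinfun_apply (F x)) (at x)"
proof -
  obtain g' where g': "(g has_derivative g') (at x)" using diff[OF assms] by (auto simp: differentiable_def)
  have "(L has_derivative (\<lambda>h. inverse (g x) * g' h)) (at x)"
    using pos[OF assms] by (auto intro!: derivative_eq_intros g' simp: divide_inverse)
  then have 1: "(L has_derivative frechet_derivative L (at x)) (at x)"
    using frechet_derivative_works differentiable_def by blast
  then have "bounded_linear (frechet_derivative L (at x))" by (rule has_derivative_bounded_linear)
  then show ?thesis using 1 by (simp add: log_gradient_def bounded_linear_Blinfun_apply)
qed

lemma continuous_log: "continuous_on \<Gamma> L"
  using has_derivative_log has_derivative_continuous continuous_at_imp_continuous_on by blast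

lemma strict_concavity:
  assumes "x \<in> \<Gamma>" "z \<in> \<Gamma>" "x \<noteq> z" "0 < t" "t < 1"
  shows "(1 - t) * L x + t * L z < L ((1 - t) *\<^sub>R x + t *\<^sub>R z)"
proof -
  have "- L ((1 - t) *\<^sub>R x + t *\<^sub>R z) < (1 - t) * - L x + t * - L z"
    using concave assms unfolding strictly_concave_on_def strictly_convex_on_def by blast
  then show ?thesis by simp
qed

lemma segment_in_cone:
  assumes "x \<in> \<Gamma>" "z \<in> \<Gamma>" "0 \<le> t" "t \<le> 1"
  shows "(1 - t) *\<^sub>R x + t *\<^sub>R z \<in> \<Gamma>"
  using convexD_alt[OF convex_cone] assms by blast

text \<open>The chord from \<open>x\<close> to \<open>z\<close> lies below the graph, so the graph minus
  the chord has a one-sided minimum at \<open>x\<close>.\<close>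
lemma tangent_le:
  assumes "x \<in> \<Gamma>" "z \<in> \<Gamma>"
  shows "L z \<le> L x + blinfun_apply (F x) (z - x)"
proof (cases "x = z")
  case False
  have "((\<lambda>t. L (x + t *\<^sub>R (z - x)) - t * (L z - L x)) has_real_derivative
      blinfun_apply (F x) (z - x) - 1 * (L z - L x)) (at 0)"
    by (intro DERIV_diff has_real_derivative_along_line has_derivative_log assms DERIV_cmult_right DERIV_ident)
  moreover have "L (x + 0 *\<^sub>R (z - x)) - 0 * (L z - L x) \<le> L (x + t *\<^sub>R (z - x)) - t * (L z - L x)"
    if "0 < t" "t < 1" for t
    using strict_concavity[OF assms False that] by (simp add: algebra_simps)
  ultimately have "blinfun_apply (F x) (z - x) - 1 * (L z - L x) \<ge> 0"
    by (rule deriv_at_right_minimum_nonneg)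
  then show ?thesis by simp
qed (simp add: blinfun.bilinear_simps)

text \<open>Equality at \<open>z\<close> would force equality at the midpoint, against strict
  concavity.\<close>
lemma tangent_less:
  assumes "x \<in> \<Gamma>" "z \<in> \<Gamma>" "x \<noteq> z"
  shows "L z < L x + blinfun_apply (F x) (z - x)"
proof -
  define m where "m = (1 - 1/2) *\<^sub>R x + (1/2) *\<^sub>R z"
  have "m \<in> \<Gamma>" unfolding m_def by (rule segment_in_cone[OF assms(1,2)]) auto
  then have "L m \<le> L x + blinfun_apply (F x) (m - x)" using tangent_le assms(1) by blast
  also have "m - x = (1/2) *\<^sub>R (z - x)" by (simp add: m_def algebra_simps flip: scaleR_left.add)
  finally have "L m \<le> L x + blinfun_apply (F x) (z - x) / 2" by (simp add: blinfun.scaleR_right)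
  moreover have "(1 - 1/2) * L x + (1/2) * L z < L m"
    unfolding m_def by (rule strict_concavity[OF assms]) auto
  ultimately show ?thesis by simp
qed

lemma gradient_inj: "inj_on F \<Gamma>"
proof (rule inj_onI, rule ccontr)
  fix x z assume "x \<in> \<Gamma>" "z \<in> \<Gamma>" "F x = F z" "x \<noteq> z"
  then show False using tangent_less[of x z] tangent_less[of z x]
    by (simp add: blinfun.diff_right)
qed

lemma gradient_eq_of_local_min:
  assumes "x \<in> \<Gamma>" "open U" "x \<in> U"
    "\<And>z. z \<in> U \<Longrightarrow> blinfun_apply y x - L x \<le> blinfun_apply y z - L z"
  shows "F x = y"
proof -
  have "((\<lambda>z. blinfun_apply y z - L z) has_derivative (\<lambda>h. blinfun_apply y h - blinfun_apply (F x) h)) (at x)"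
    by (intro has_derivative_diff has_derivative_log assms bounded_linear_imp_has_derivative blinfun.bounded_linear_right)
  moreover have "eventually (\<lambda>z. blinfun_apply y x - L x \<le> blinfun_apply y z - L z) (at x)"
    using assms(2-4) eventually_at_topological by blast
  ultimately have "(\<lambda>h. blinfun_apply y h - blinfun_apply (F x) h) = (\<lambda>h. 0)"
    by (rule has_derivative_local_min)
  then have "blinfun_apply y h - blinfun_apply (F x) h = 0" for h by (rule fun_cong)
  then show ?thesis by (intro blinfun_eqI) (simp add: eq_iff)
qed

text \<open>The strict minimum of \<open>z \<mapsto> \<langle>F x\<^sub>0, z\<rangle> - L z\<close> at
  \<open>x\<^sub>0\<close> exceeds its value there by a fixed amount on a small sphere. A small change of
  the functional does not destroy this, so the perturbed function attains its minimum over the ball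
  inside, at a point with gradient \<open>y\<close>. This gives at once that the image of
  \<open>F\<close> is open and that its inverse is continuous.\<close>
lemma gradient_locally_open:
  assumes x0: "x0 \<in> \<Gamma>" and r: "r > 0"
  shows "\<exists>\<delta>>0. \<forall>y. norm (y - F x0) < \<delta> \<longrightarrow> (\<exists>x\<in>\<Gamma>. norm (x - x0) < r \<and> F x = y)"
proof -
  obtain r' where r': "r' > 0" "cball x0 r' \<subseteq> \<Gamma>" using open_cone x0 open_contains_cball by blast
  define \<rho> where "\<rho> = min r' (r/2)"
  have \<rho>: "\<rho> > 0" "\<rho> < r" "cball x0 \<rho> \<subseteq> \<Gamma>" using r r' by (auto simp: \<rho>_def)
  have cont: "continuous_on (cball x0 \<rho>) (\<lambda>x. blinfun_apply y x - L x)" for y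
    using \<rho>(3) by (intro continuous_intros continuous_on_subset[OF continuous_log])
  obtain s where s: "s \<in> sphere x0 \<rho>"
      "\<And>x. x \<in> sphere x0 \<rho> \<Longrightarrow> blinfun_apply (F x0) s - L s \<le> blinfun_apply (F x0) x - L x"
    using continuous_attains_inf[OF compact_sphere, of x0 \<rho> "\<lambda>x. blinfun_apply (F x0) x - L x"]
      continuous_on_subset[OF cont, of "sphere x0 \<rho>"] \<rho>(1) by (force simp: sphere_eq_empty)
  have sG: "s \<in> \<Gamma>" "s \<noteq> x0" using s(1) \<rho> by auto
  define \<epsilon> where "\<epsilon> = (blinfun_apply (F x0) s - L s) - (blinfun_apply (F x0) x0 - L x0)"
  have \<epsilon>: "\<epsilon> > 0" using tangent_less[OF x0 sG(1)] sG(2) by (auto simp: \<epsilon>_def blinfun.diff_right)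
  show ?thesis
  proof (intro exI[of _ "\<epsilon> / \<rho>"] conjI allI impI)
    show "\<epsilon> / \<rho> > 0" using \<epsilon> \<rho> by simp
    fix y assume y: "norm (y - F x0) < \<epsilon> / \<rho>"
    obtain x where x: "x \<in> cball x0 \<rho>"
       "\<And>z. z \<in> cball x0 \<rho> \<Longrightarrow> blinfun_apply y x - L x \<le> blinfun_apply y z - L z"
      using continuous_attains_inf[OF compact_cball _ cont[of y]] \<rho>(1) by force
    have "x \<notin> sphere x0 \<rho>"
    proof
      assume xs: "x \<in> sphere x0 \<rho>"
      have "\<bar>blinfun_apply (y - F x0) (x - x0)\<bar> \<le> norm (y - F x0) * norm (x - x0)"
        using norm_blinfun[of "y - F x0" "x - x0"] by simp
      also have "\<dots> = norm (y - F x0) * \<rho>" using xs by (simp add: dist_norm norm_minus_commute)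
      also have "\<dots> < \<epsilon>" using y \<rho>(1) by (simp add: field_simps)
      finally have "\<bar>blinfun_apply (y - F x0) (x - x0)\<bar> < \<epsilon>" .
      moreover have "\<epsilon> \<le> (blinfun_apply (F x0) x - L x) - (blinfun_apply (F x0) x0 - L x0)"
        using s(2)[OF xs] by (simp add: \<epsilon>_def)
      moreover have "blinfun_apply y x - L x \<le> blinfun_apply y x0 - L x0"
        using x(2)[of x0] \<rho>(1) by simp
      ultimately show False by (simp add: blinfun.bilinear_simps)
    qed
    then have xb: "x \<in> ball x0 \<rho>" using x(1) by (simp add: less_le)
    have "F x = y"
      by (rule gradient_eq_of_local_min[of x "ball x0 \<rho>"]) (use xb x \<rho> in auto)
    then show "\<exists>x\<in>\<Gamma>. norm (x - x0) < r \<and> F x = y"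
      using xb x(1) \<rho> by (intro bexI[of _ x]) (auto simp: dist_norm norm_minus_commute)
  qed
qed

lemma gradient_image_open: "open (F ` \<Gamma>)"
proof (rule openI)
  fix y assume "y \<in> F ` \<Gamma>"
  then obtain x0 where x0: "x0 \<in> \<Gamma>" "y = F x0" by blast
  then obtain \<delta> where "\<delta> > 0" "\<And>y. norm (y - F x0) < \<delta> \<Longrightarrow> y \<in> F ` \<Gamma>"
    using gradient_locally_open[OF x0(1), of 1] by auto
  then show "\<exists>e>0. ball y e \<subseteq> F ` \<Gamma>"
    by (intro exI[of _ \<delta>]) (auto simp: x0(2) dist_norm norm_minus_commute)
qed

lemma gradient_in_polar: 
  assumes "x \<in> \<Gamma>" shows "F x \<in> polar \<Gamma>"
proof -
  have "blinfun_apply (F x) z \<ge> 0" if z: "z \<in> \<Gamma>" for z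
  proof (rule deriv_at_right_minimum_nonneg)
    show "((\<lambda>t. L (x + t *\<^sub>R z)) has_real_derivative blinfun_apply (F x) z) (at 0)"
      by (intro has_real_derivative_along_line has_derivative_log assms)
    show "L (x + 0 *\<^sub>R z) \<le> L (x + t *\<^sub>R z)" if "0 < t" "t < 1" for t :: real
      using mono[OF assms scale[OF z that(1)]] pos[OF assms] by simp
  qed
  then show ?thesis by (simp add: polar_def)
qed

lemma gradient_image_interior: "F ` \<Gamma> \<subseteq> interior (polar \<Gamma>)"
  by (intro interior_maximal gradient_image_open) (use gradient_in_polar in auto)

lemma interior_polar_nonempty: "interior (polar \<Gamma>) \<noteq> {}"
  using gradient_image_interior nonempty by blast

lemma open_polar_interior: "open_polar \<Gamma> = interior (polar \<Gamma>)"
  by (rule open_polar_eq_interior[OF interior_polar_nonempty])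

text \<open>Euler's relation: along a ray \<open>L\<close> equals \<open>N log t\<close> up to a
  constant.\<close>
lemma gradient_euler:
  assumes "x \<in> \<Gamma>"
  shows "blinfun_apply (F x) x = N"
proof -
  have D: "((\<lambda>t. L (x + t *\<^sub>R x)) has_real_derivative blinfun_apply (F x) x) (at 0)"
    by (intro has_real_derivative_along_line has_derivative_log assms)
  have "((\<lambda>t. N * ln (1 + t) + L x) has_real_derivative N) (at 0)"
    by (auto intro!: derivative_eq_intros)
  moreover have "eventually (\<lambda>t. N * ln (1 + t) + L x = L (x + t *\<^sub>R x)) (nhds (0::real))"
  proof -
    have "eventually (\<lambda>t. t > -1) (nhds (0::real))"
      using eventually_nhds_in_open[of "{-1<..}" "0::real"] by simp
    then show ?thesis
    proof eventually_elim
      case (elim t)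
      then have t: "1 + t > 0" by simp
      have "g (x + t *\<^sub>R x) = (1 + t) powr N * g x" using homog[OF assms t] by (simp add: algebra_simps)
      then show ?case using t pos[OF assms] by (simp add: ln_mult ln_powr)
    qed
  qed
  ultimately have "((\<lambda>t. L (x + t *\<^sub>R x)) has_real_derivative N) (at 0)"
    using DERIV_cong_ev by fast
  then show ?thesis using D DERIV_unique by blast
qed

end

locale legendre_cone = log_concave_cone +
  assumes compact_sublevel: "y \<in> open_polar \<Gamma> \<Longrightarrow> compact {x \<in> \<Gamma>. blinfun_apply y x - ln (g x) \<le> c}"
begin

abbreviation "g' \<equiv> dual_function g \<Gamma>"

text \<open>Minimisers exist by compactness of the sublevel sets, and the gradient at the minimiser is
  the given functional.\<close>
lemma gradient_image: "F ` \<Gamma> = open_polar \<Gamma>"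
proof
  show "F ` \<Gamma> \<subseteq> open_polar \<Gamma>" using gradient_image_interior open_polar_interior by simp
  show "open_polar \<Gamma> \<subseteq> F ` \<Gamma>"
  proof
    fix y assume y: "y \<in> open_polar \<Gamma>"
    obtain x1 where x1: "x1 \<in> \<Gamma>" using nonempty by blast
    define S where "S = {x \<in> \<Gamma>. blinfun_apply y x - L x \<le> blinfun_apply y x1 - L x1}"
    have "compact S" "S \<noteq> {}" using compact_sublevel[OF y] x1 by (auto simp: S_def)
    moreover have "continuous_on S (\<lambda>x. blinfun_apply y x - L x)"
      by (intro continuous_intros continuous_on_subset[OF continuous_log]) (auto simp: S_def)
    ultimately obtain x where x: "x \<in> S" "\<And>z. z \<in> S \<Longrightarrow> blinfun_apply y x - L x \<le> blinfun_apply y z - L z"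
      using continuous_attains_inf[of S] by blast
    have "blinfun_apply y x - L x \<le> blinfun_apply y z - L z" if "z \<in> \<Gamma>" for z
      using x that by (cases "z \<in> S") (auto simp: S_def)
    then have "F x = y" using x(1) open_cone by (intro gradient_eq_of_local_min[of x \<Gamma>]) (auto simp: S_def)
    then show "y \<in> F ` \<Gamma>" using x(1) by (auto simp: S_def)
  qed
qed

lemma dual_function_gradient: "x \<in> \<Gamma> \<Longrightarrow> g' (F x) = 1 / g x"
  by (simp add: dual_function_def the_inv_into_f_f gradient_inj)

text \<open>By Euler's relation the two tangent inequalities between \<open>x\<close> and
  \<open>z\<close> squeeze \<open>L x - L z\<close> between \<open>\<langle>F z - F x, z\<rangle>\<close>
  and \<open>\<langle>F z - F x, x\<rangle>\<close>. This is the envelope theorem in quantitative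
  form.\<close>
lemma log_dual_difference:
  assumes "x \<in> \<Gamma>" "z \<in> \<Gamma>"
  shows "\<bar>ln (g' (F z)) - ln (g' (F x)) - blinfun_apply (F z - F x) x\<bar> \<le> norm (F z - F x) * norm (z - x)"
proof -
  have diff: "ln (g' (F z)) - ln (g' (F x)) = L x - L z"
    using assms pos by (simp add: dual_function_gradient ln_div)
  have "L z \<le> L x + blinfun_apply (F x) (z - x)" "L x \<le> L z + blinfun_apply (F z) (x - z)"
    using tangent_le assms by auto
  then have "L x - L z \<ge> blinfun_apply (F z - F x) z" "L x - L z \<le> blinfun_apply (F z - F x) x"
    using gradient_euler assms by (auto simp: blinfun.bilinear_simps)
  moreover have "\<bar>blinfun_apply (F z - F x) (z - x)\<bar> \<le> norm (F z - F x) * norm (z - x)"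
    using norm_blinfun[of "F z - F x" "z - x"] by simp
  ultimately show ?thesis unfolding diff by (simp add: blinfun.diff_right)
qed

text \<open>The error in the preceding estimate is of smaller order because \<open>z\<close> tends to
  \<open>x\<close> as \<open>F z\<close> tends to \<open>F x\<close>.\<close>
lemma log_gradient_dual:
  assumes x: "x \<in> \<Gamma>"
  shows "log_gradient g' (F x) = to_bidual x"
proof (rule log_gradient_eqI)
  show "((\<lambda>y. ln (g' y)) has_derivative blinfun_apply (to_bidual x)) (at (F x))"
    unfolding has_derivative_at_alt
  proof (intro conjI allI impI)
    fix e :: real assume "e > 0"
    then obtain \<delta> where \<delta>: "\<delta> > 0" "\<And>y. norm (y - F x) < \<delta> \<Longrightarrow> \<exists>z\<in>\<Gamma>. norm (z - x) < e \<and> F z = y"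
      using gradient_locally_open[OF x] by blast
    have "norm (ln (g' y) - ln (g' (F x)) - blinfun_apply (to_bidual x) (y - F x)) \<le> e * norm (y - F x)"
      if y: "norm (y - F x) < \<delta>" for y
    proof -
      obtain z where z: "z \<in> \<Gamma>" "norm (z - x) < e" "F z = y" using \<delta>(2)[OF y] by blast
      have "norm (ln (g' y) - ln (g' (F x)) - blinfun_apply (to_bidual x) (y - F x)) \<le> norm (y - F x) * norm (z - x)"
        using log_dual_difference[OF x z(1)] z(3) by simp
      also have "\<dots> \<le> norm (y - F x) * e" using z(2) by (intro mult_left_mono) auto
      finally show ?thesis by (simp add: mult.commute)
    qed
    then show "\<exists>d>0. \<forall>y. norm (y - F x) < d \<longrightarrow> norm (ln (g' y) - ln (g' (F x)) - blinfun_apply (to_bidual x) (y - F x)) \<le> e * norm (y - F x)"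
      using \<delta>(1) by blast
  qed (rule blinfun.bounded_linear_right)
qed

lemma double_dual_cone: "open_polar (open_polar \<Gamma>) = to_bidual ` \<Gamma>"
  by (rule open_bipolar[OF cone nonempty interior_polar_nonempty])

lemma double_dual_function:
  assumes x: "x \<in> \<Gamma>"
  shows "dual_function g' (open_polar \<Gamma>) (to_bidual x) = g x"
proof -
  have "inj_on (log_gradient g') (F ` \<Gamma>)"
    by (rule inj_onI) (auto simp: log_gradient_dual)
  then have "the_inv_into (open_polar \<Gamma>) (log_gradient g') (to_bidual x) = F x"
    unfolding gradient_image[symmetric] log_gradient_dual[OF x, symmetric]
    using x by (intro the_inv_into_f_f) auto
  then show ?thesis by (simp add: dual_function_def[of g' "open_polar \<Gamma>"] dual_function_gradient[OF x])
qed

end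

section \<open>Power series are differentiable at their centre\<close>

lemma sum_nat_eq_1:
  fixes \<alpha> :: "'b \<Rightarrow> nat"
  assumes "finite B" "(\<Sum>b\<in>B. \<alpha> b) = 1"
  obtains c where "c \<in> B" "\<alpha> c = 1" "\<And>b. b \<in> B \<Longrightarrow> b \<noteq> c \<Longrightarrow> \<alpha> b = 0"
  using assms sum_eq_1_iff[OF assms(1), of \<alpha>] by auto

lemma monomial_of_degree_one:
  fixes \<alpha> :: "'a::euclidean_space \<Rightarrow> nat"
  assumes "(\<Sum>b\<in>Basis. \<alpha> b) = 1"
  shows "\<exists>c. \<forall>h. (\<Prod>b\<in>Basis. (h \<bullet> b) ^ \<alpha> b) = h \<bullet> c"
proof -
  obtain c where c: "c \<in> Basis" "\<alpha> c = 1" "\<And>b. b \<in> Basis \<Longrightarrow> b \<noteq> c \<Longrightarrow> \<alpha> b = 0"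
    using sum_nat_eq_1[OF finite_Basis assms] by blast
  have "(\<Prod>b\<in>Basis. (h \<bullet> b) ^ \<alpha> b) = h \<bullet> c" for h
  proof -
    have "(\<Prod>b\<in>Basis. (h \<bullet> b) ^ \<alpha> b) = (\<Prod>b\<in>{c}. (h \<bullet> b) ^ \<alpha> b)"
      by (rule prod.mono_neutral_right) (use c in auto)
    then show ?thesis using c by simp
  qed
  then show ?thesis by blast
qed

lemma monomial_bound:
  fixes h :: "'a::euclidean_space"
  shows "\<bar>\<Prod>b\<in>Basis. (h \<bullet> b) ^ \<alpha> b\<bar> \<le> norm h ^ (\<Sum>b\<in>Basis. \<alpha> b)"
proof -
  have "\<bar>\<Prod>b\<in>Basis. (h \<bullet> b) ^ \<alpha> b\<bar> = (\<Prod>b\<in>Basis. \<bar>h \<bullet> b\<bar> ^ \<alpha> b)"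
    by (simp add: abs_prod power_abs)
  also have "\<dots> \<le> (\<Prod>b\<in>Basis. norm h ^ \<alpha> b)"
    by (intro prod_mono conjI power_mono) (auto simp: Basis_le_norm)
  finally show ?thesis by (simp add: power_sum)
qed

lemma finite_multiindices_degree_one:
  "finite {\<alpha> \<in> (Basis :: 'a::euclidean_space set) \<rightarrow>\<^sub>E (UNIV :: nat set). (\<Sum>b\<in>Basis. \<alpha> b) = 1}"
proof (rule finite_subset)
  show "finite ((Basis :: 'a set) \<rightarrow>\<^sub>E {0::nat, 1})" by (intro finite_PiE) auto
  show "{\<alpha> \<in> (Basis :: 'a set) \<rightarrow>\<^sub>E (UNIV :: nat set). (\<Sum>b\<in>Basis. \<alpha> b) = 1} \<subseteq> Basis \<rightarrow>\<^sub>E {0, 1}"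
  proof
    fix \<alpha> assume \<alpha>: "\<alpha> \<in> {\<alpha> \<in> (Basis :: 'a set) \<rightarrow>\<^sub>E (UNIV :: nat set). (\<Sum>b\<in>Basis. \<alpha> b) = 1}"
    then obtain c where "\<And>b. b \<in> Basis \<Longrightarrow> b \<noteq> c \<Longrightarrow> \<alpha> b = 0" "\<alpha> c = 1"
      using sum_nat_eq_1[OF finite_Basis, of \<alpha>] by blast
    then have "\<alpha> b \<in> {0, 1}" if "b \<in> Basis" for b using that by (cases "b = c") auto
    then show "\<alpha> \<in> Basis \<rightarrow>\<^sub>E {0, 1}" using \<alpha> by (auto simp: PiE_iff)
  qed
qed

text \<open>The terms of degree one of the expansion at \<open>x\<close> form a linear function, and
  absolute convergence bounds the terms of degree at least two by a multiple of
  \<open>|h|\<^sup>2\<close>.\<close>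
lemma real_analytic_imp_differentiable:
  fixes f :: "'a::euclidean_space \<Rightarrow> real"
  assumes "real_analytic_on f S" "x \<in> S"
  shows "f differentiable (at x)"
proof -
  define I where "I = (Basis :: 'a set) \<rightarrow>\<^sub>E (UNIV :: nat set)"
  define deg where "deg = (\<lambda>\<alpha> :: 'a \<Rightarrow> nat. \<Sum>b\<in>Basis. \<alpha> b)"
  define mon where "mon = (\<lambda>h (\<alpha> :: 'a \<Rightarrow> nat). \<Prod>b\<in>Basis. (h \<bullet> b) ^ \<alpha> b)"
  obtain r a where r: "r > 0" and
     a: "\<And>y. y \<in> ball x r \<Longrightarrow> ((\<lambda>\<alpha>. a \<alpha> * mon (y - x) \<alpha>) has_sum f y) I"
    using assms(1)[unfolded real_analytic_on_def, rule_format, OF assms(2)]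
    unfolding I_def mon_def by blast
  have hs: "((\<lambda>\<alpha>. a \<alpha> * mon h \<alpha>) has_sum f (x + h)) I" if "norm h < r" for h
    using a[of "x + h"] that by (simp add: dist_norm)
  define J where "J = {\<alpha>\<in>I. deg \<alpha> = 1}"
  define K where "K = {\<alpha>\<in>I. deg \<alpha> \<ge> 2}"
  \<comment> \<open>The only multi-index of degree zero; it is undefined outside the basis, like all
    members of \<open>I\<close>.\<close>
  define z0 where "z0 = (\<lambda>b\<in>(Basis :: 'a set). 0 :: nat)"
  have finJ: "finite J" unfolding J_def I_def deg_def by (rule finite_multiindices_degree_one)
  have deg0: "deg \<alpha> = 0 \<longleftrightarrow> \<alpha> = z0" if "\<alpha> \<in> I" for \<alpha>
    using that unfolding deg_def z0_def I_def by (auto simp: PiE_iff extensional_def fun_eq_iff restrict_def)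
  have z0_I: "z0 \<in> I" by (auto simp: z0_def I_def)
  have deg_z0: "deg z0 = 0" using deg0 z0_I by blast
  have split: "I = insert z0 J \<union> K"
  proof -
    have "deg \<alpha> = 0 \<or> deg \<alpha> = 1 \<or> deg \<alpha> \<ge> 2" for \<alpha> by linarith
    then show ?thesis using deg0 z0_I by (auto simp: J_def K_def)
  qed
  have disj: "insert z0 J \<inter> K = {}" using deg_z0 by (auto simp: J_def K_def)
  have z0_J: "z0 \<notin> J" using deg_z0 by (auto simp: J_def)
  have mon_z0: "mon h z0 = 1" for h by (simp add: mon_def z0_def)
  define D where "D = (\<lambda>h. \<Sum>\<alpha>\<in>J. a \<alpha> * mon h \<alpha>)"
  have rest: "((\<lambda>\<alpha>. a \<alpha> * mon h \<alpha>) has_sum (f (x + h) - a z0 - D h)) K" if "norm h < r" for h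
  proof -
    have "((\<lambda>\<alpha>. a \<alpha> * mon h \<alpha>) has_sum (\<Sum>\<alpha>\<in>insert z0 J. a \<alpha> * mon h \<alpha>)) (insert z0 J)"
      using finJ by (intro has_sum_finite) auto
    then have 1: "((\<lambda>\<alpha>. a \<alpha> * mon h \<alpha>) has_sum (a z0 + D h)) (insert z0 J)"
      using finJ z0_J by (simp add: D_def mon_z0)
    have "((\<lambda>\<alpha>. a \<alpha> * mon h \<alpha>) has_sum (f (x + h) - (a z0 + D h))) (I - insert z0 J)"
      by (rule has_sum_Diff[OF hs[OF that] 1]) (use split in auto)
    moreover have "I - insert z0 J = K" using split disj by auto
    ultimately show ?thesis by (simp add: algebra_simps)
  qed
  have linJ: "\<exists>c. \<forall>h. mon h \<alpha> = h \<bullet> c" if "\<alpha> \<in> J" for \<alpha>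
    unfolding mon_def by (rule monomial_of_degree_one) (use that in \<open>simp add: J_def deg_def\<close>)
  have "bounded_linear (\<lambda>h. a \<alpha> * mon h \<alpha>)" if \<alpha>: "\<alpha> \<in> J" for \<alpha>
  proof -
    obtain c where "\<And>h. mon h \<alpha> = h \<bullet> c" using linJ[OF \<alpha>] by blast
    then show ?thesis by (simp add: bounded_linear_mult_right bounded_linear_const_mult bounded_linear_inner_left)
  qed
  then have blD: "bounded_linear D" unfolding D_def by (intro bounded_linear_sum) auto
  have a0: "f x = a z0"
  proof -
    have D_0: "D 0 = 0" using linear_0[OF bounded_linear.linear[OF blD]] .
    have "a \<alpha> * mon 0 \<alpha> = 0" if "\<alpha> \<in> K" for \<alpha>
    proof -
      have "\<bar>mon 0 \<alpha>\<bar> \<le> norm (0::'a) ^ deg \<alpha>" unfolding mon_def deg_def by (rule monomial_bound)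
      moreover have "deg \<alpha> \<ge> 2" using that by (simp add: K_def)
      ultimately show ?thesis by (simp add: power_0_left)
    qed
    then have "((\<lambda>\<alpha>. a \<alpha> * mon 0 \<alpha>) has_sum 0) K" by (rule has_sum_0)
    then show ?thesis using rest[of 0] r D_0 has_sum_unique by fastforce
  qed
  \<comment> \<open>Absolute convergence at the diagonal point with coordinates \<open>\<rho>\<close> bounds the coefficients in \<open>K\<close>.\<close>
  define \<rho> where "\<rho> = r / (2 * DIM('a))"
  have \<rho>: "\<rho> > 0" using r by (simp add: \<rho>_def)
  define d where "d = (\<Sum>b\<in>(Basis::'a set). \<rho> *\<^sub>R b)"
  have "norm d \<le> (\<Sum>b\<in>(Basis::'a set). norm (\<rho> *\<^sub>R b))" unfolding d_def by (rule norm_sum)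
  also have "\<dots> = r / 2" using r by (simp add: \<rho>_def)
  finally have "norm d < r" using r by simp
  have mond: "mon d \<alpha> = \<rho> ^ deg \<alpha>" for \<alpha>
  proof -
    have "d \<bullet> b = \<rho>" if "b \<in> Basis" for b using that by (simp add: d_def inner_sum_left inner_Basis if_distrib[of "(*) \<rho>"] cong: if_cong)
    then show ?thesis by (simp add: mon_def deg_def power_sum)
  qed
  define M where "M = (\<Sum>\<^sub>\<infinity>\<alpha>\<in>K. \<bar>a \<alpha>\<bar> * \<rho> ^ deg \<alpha>)"
  have "(\<lambda>\<alpha>. a \<alpha> * mon d \<alpha>) summable_on K" using rest[OF \<open>norm d < r\<close>] has_sum_imp_summable by blast
  then have "(\<lambda>\<alpha>. \<bar>a \<alpha> * mon d \<alpha>\<bar>) summable_on K"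
    using summable_on_iff_abs_summable_on_real by fastforce
  then have sumM: "(\<lambda>\<alpha>. \<bar>a \<alpha>\<bar> * \<rho> ^ deg \<alpha>) summable_on K" using \<rho> by (simp add: mond abs_mult)
  have M0: "M \<ge> 0" unfolding M_def using \<rho> by (intro infsum_nonneg) auto
  have bound: "\<bar>f (x + h) - f x - D h\<bar> \<le> M / \<rho>\<^sup>2 * (norm h)\<^sup>2" if h: "norm h < r" "norm h \<le> \<rho>" for h
  proof -
    have "norm (a \<alpha> * mon h \<alpha>) \<le> (norm h / \<rho>)\<^sup>2 * (\<bar>a \<alpha>\<bar> * \<rho> ^ deg \<alpha>)" if "\<alpha> \<in> K" for \<alpha>
    proof -
      have deg2: "deg \<alpha> \<ge> 2" using that by (simp add: K_def)
      have "\<bar>mon h \<alpha>\<bar> \<le> norm h ^ deg \<alpha>" unfolding mon_def deg_def by (rule monomial_bound)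
      also have "\<dots> = (norm h / \<rho>) ^ deg \<alpha> * \<rho> ^ deg \<alpha>" using \<rho> by (simp add: power_divide)
      also have "\<dots> \<le> (norm h / \<rho>)\<^sup>2 * \<rho> ^ deg \<alpha>"
        using h \<rho> deg2 by (intro mult_right_mono power_decreasing) auto
      finally have "\<bar>a \<alpha>\<bar> * \<bar>mon h \<alpha>\<bar> \<le> \<bar>a \<alpha>\<bar> * ((norm h / \<rho>)\<^sup>2 * \<rho> ^ deg \<alpha>)" by (rule mult_left_mono) simp
      then show ?thesis by (simp add: abs_mult mult_ac)
    qed
    moreover have "((\<lambda>\<alpha>. (norm h / \<rho>)\<^sup>2 * (\<bar>a \<alpha>\<bar> * \<rho> ^ deg \<alpha>)) has_sum ((norm h / \<rho>)\<^sup>2 * M)) K"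
      unfolding M_def by (intro has_sum_cmult_right has_sum_infsum sumM)
    ultimately have "norm (f (x + h) - a z0 - D h) \<le> (norm h / \<rho>)\<^sup>2 * M"
      by (intro norm_infsum_le[OF rest[OF h(1)]])
    then show ?thesis by (simp add: a0 power_divide mult.commute)
  qed
  have "(f has_derivative D) (at x)"
    unfolding has_derivative_at_alt
  proof (intro conjI allI impI)
    show "bounded_linear D" by (rule blD)
    fix e :: real assume e: "e > 0"
    define \<delta> where "\<delta> = min (min r \<rho>) (e * \<rho>\<^sup>2 / (M + 1))"
    have \<delta>: "\<delta> > 0" using r \<rho> e M0 by (auto simp: \<delta>_def intro!: divide_pos_pos mult_pos_pos)
    have "norm (f y - f x - D (y - x)) \<le> e * norm (y - x)" if y: "norm (y - x) < \<delta>" for y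
    proof -
      have "\<bar>f (x + (y - x)) - f x - D (y - x)\<bar> \<le> M / \<rho>\<^sup>2 * (norm (y - x))\<^sup>2"
        by (rule bound) (use y in \<open>auto simp: \<delta>_def\<close>)
      also have "\<dots> = (M / \<rho>\<^sup>2 * norm (y - x)) * norm (y - x)" by (simp add: power2_eq_square)
      also have "\<dots> \<le> e * norm (y - x)"
      proof (rule mult_right_mono)
        have "M / \<rho>\<^sup>2 * norm (y - x) \<le> (M + 1) / \<rho>\<^sup>2 * (e * \<rho>\<^sup>2 / (M + 1))"
          using y M0 by (intro mult_mono divide_right_mono) (auto simp: \<delta>_def)
        also have "\<dots> = e"
        proof -
          have "M + 1 \<noteq> 0" "\<rho>\<^sup>2 \<noteq> 0" using M0 \<rho> by auto
          then show ?thesis by simp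
        qed
        finally show "M / \<rho>\<^sup>2 * norm (y - x) \<le> e" .
      qed simp
      finally show ?thesis by simp
    qed
    then show "\<exists>d>0. \<forall>y. norm (y - x) < d \<longrightarrow> norm (f y - f x - D (y - x)) \<le> e * norm (y - x)"
      using \<delta> by blast
  qed
  then show ?thesis by (auto simp: differentiable_def)
qed

section \<open>Complexified polynomials and half plane estimates\<close>

text \<open>Pairs \<open>(x, y)\<close> stand for the vectors \<open>x + \<i> y\<close> of the
  complexification, with this as scalar multiplication.\<close>
definition cscale :: "complex \<Rightarrow> 'a \<times> 'a \<Rightarrow> 'a::real_vector \<times> 'a" where
  "cscale z X = (Re z *\<^sub>R fst X - Im z *\<^sub>R snd X, Re z *\<^sub>R snd X + Im z *\<^sub>R fst X)"

lemma cscale_of_real: "cscale (of_real r) X = r *\<^sub>R X"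
  by (simp add: cscale_def prod_eq_iff)

lemma cscale_add_right: "cscale z (X + Y) = cscale z X + cscale z Y"
  by (simp add: cscale_def prod_eq_iff scaleR_add_right)

lemma cscale_cscale: "cscale z (cscale w X) = cscale (z * w) X"
  by (simp add: cscale_def prod_eq_iff algebra_simps)

lemma cscale_0 [simp]: "cscale 0 X = 0" and cscale_1 [simp]: "cscale 1 X = X"
  by (simp_all add: cscale_def prod_eq_iff)

lemma continuous_on_cscale [continuous_intros]:
  fixes f :: "'b::topological_space \<Rightarrow> complex" and h :: "'b \<Rightarrow> 'a::real_normed_vector \<times> 'a"
  assumes "continuous_on S f" "continuous_on S h"
  shows "continuous_on S (\<lambda>x. cscale (f x) (h x))"
  unfolding cscale_def by (intro continuous_intros assms)

text \<open>The extension is built along the inductive definition of polynomial functions. Beyond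
  continuity, the only trace of its being a polynomial that is kept is that it restricts to a polynomial
  on complex lines.\<close>
lemma real_polynomial_function_complexification:
  fixes g :: "'a::real_normed_vector \<Rightarrow> real"
  assumes "real_polynomial_function g"
  shows "\<exists>G :: 'a \<times> 'a \<Rightarrow> complex. (\<forall>x. G (x, 0) = of_real (g x)) \<and> continuous_on UNIV G \<and>
           (\<forall>X D. \<exists>p. \<forall>z. poly p z = G (X + cscale z D))"
  using assms
proof (induction rule: real_polynomial_function.induct)
  case (linear f)
  then interpret f: bounded_linear f .
  define G where "G = (\<lambda>X :: 'a \<times> 'a. Complex (f (fst X)) (f (snd X)))"
  have "continuous_on UNIV G" unfolding G_def
    by (intro continuous_on_Complex f.continuous_on continuous_intros)
  moreover have "\<exists>p. \<forall>z. poly p z = G (X + cscale z D)" for X D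
    by (intro exI[of _ "[:G X, G D:]"]) (auto simp: G_def cscale_def f.add f.diff f.scaleR complex_eq_iff)
  ultimately show ?case by (intro exI[of _ G]) (auto simp: G_def f.zero complex_eq_iff)
next
  case (const c)
  have "\<exists>p. \<forall>z. poly p z = (of_real c :: complex)" by (intro exI[of _ "[:of_real c:]"]) auto
  then show ?case by (intro exI[of _ "\<lambda>_. of_real c"]) auto
next
  case (add f g)
  then obtain A B where AB: "\<forall>x. A (x, 0) = of_real (f x)" "continuous_on UNIV A" "\<And>X D. \<exists>p. \<forall>z. poly p z = A (X + cscale z D)"
     "\<forall>x. B (x, 0) = of_real (g x)" "continuous_on UNIV B" "\<And>X D. \<exists>p. \<forall>z. poly p z = B (X + cscale z D)"
    by blast
  have "\<exists>p. \<forall>z. poly p z = A (X + cscale z D) + B (X + cscale z D)" for X D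
    using AB(3)[of X D] AB(6)[of X D] by (metis poly_add)
  then show ?case using AB by (intro exI[of _ "\<lambda>X. A X + B X"]) (auto intro: continuous_on_add)
next
  case (mult f g)
  then obtain A B where AB: "\<forall>x. A (x, 0) = of_real (f x)" "continuous_on UNIV A" "\<And>X D. \<exists>p. \<forall>z. poly p z = A (X + cscale z D)"
     "\<forall>x. B (x, 0) = of_real (g x)" "continuous_on UNIV B" "\<And>X D. \<exists>p. \<forall>z. poly p z = B (X + cscale z D)"
    by blast
  have "\<exists>p. \<forall>z. poly p z = A (X + cscale z D) * B (X + cscale z D)" for X D
    using AB(3)[of X D] AB(6)[of X D] by (metis poly_mult)
  then show ?case using AB by (intro exI[of _ "\<lambda>X. A X * B X"]) (auto intro: continuous_on_mult)
qed

lemma poly_eq_if_eq_on_reals: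
  fixes p q :: "complex poly"
  assumes "\<And>t::real. poly p (of_real t) = poly q (of_real t)"
  shows "p = q"
proof (rule ccontr)
  assume "p \<noteq> q"
  then have "finite {z. poly (p - q) z = 0}" by (intro poly_roots_finite) auto
  moreover have "range complex_of_real \<subseteq> {z. poly (p - q) z = 0}" using assms by auto
  ultimately have "finite (range complex_of_real)" by (rule finite_subset[rotated])
  then show False using finite_imageD[of complex_of_real UNIV] infinite_UNIV_char_0[where 'a = real]
    by (auto simp: inj_on_def)
qed

text \<open>For a homogeneous form this is applied to its restrictions to \<open>z \<mapsto> X + z
  D\<close> and \<open>z \<mapsto> D + z X\<close>, of which one is the other read backwards. The power
  of \<open>z\<close> multiplied to both sides of the comparison below is there because the degree of
  \<open>q\<close> might a priori exceed \<open>N\<close>.\<close>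
lemma degree_of_reversed_poly:
  fixes p q :: "'a::field_char_0 poly"
  assumes pq: "\<And>z. z \<noteq> 0 \<Longrightarrow> poly p z = z ^ N * poly q (inverse z)" and q0: "poly q 0 \<noteq> 0"
  shows "degree p = N \<and> lead_coeff p = poly q 0"
proof -
  have c0: "coeff q 0 \<noteq> 0" using q0 by (simp add: poly_0_coeff_0)
  have eq: "monom 1 (degree q) * p = monom 1 N * reflect_poly q"
  proof (rule ccontr)
    assume "monom 1 (degree q) * p \<noteq> monom 1 N * reflect_poly q"
    then have "finite {z. poly (monom 1 (degree q) * p - monom 1 N * reflect_poly q) z = 0}"
      by (intro poly_roots_finite) auto
    moreover have "UNIV - {0} \<subseteq> {z. poly (monom 1 (degree q) * p - monom 1 N * reflect_poly q) z = 0}"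
      by (auto simp: poly_monom pq poly_reflect_poly_nz)
    ultimately have "finite (UNIV - {0 :: 'a})" by (rule finite_subset[rotated])
    then show False by (simp add: infinite_UNIV_char_0)
  qed
  have r: "reflect_poly q \<noteq> 0" "degree (reflect_poly q) = degree q" "lead_coeff (reflect_poly q) = coeff q 0"
    using c0 by (auto simp: coeff_reflect_poly)
  have "p \<noteq> 0" using eq r by (auto simp: monom_eq_0_iff)
  then have "degree (monom 1 (degree q) * p) = degree q + degree p"
    by (simp add: degree_mult_eq degree_monom_eq monom_eq_0_iff)
  moreover have "degree (monom 1 N * reflect_poly q) = N + degree q"
    using r by (simp add: degree_mult_eq degree_monom_eq monom_eq_0_iff)
  ultimately have "degree p = N" using eq by simp
  moreover have "lead_coeff (monom 1 (degree q) * p) = lead_coeff p" 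
    "lead_coeff (monom 1 N * reflect_poly q) = coeff q 0"
    using r(3) by (simp_all only: lead_coeff_mult lead_coeff_monom mult_1)
  ultimately show ?thesis using eq by (simp add: poly_0_coeff_0)
qed

text \<open>Every root lies below the real axis, hence at distance at least \<open>Im z\<close> from
  \<open>z\<close>. The bound depends on the degree and the leading coefficient only, so it survives
  limits of polynomials and replaces continuity of roots.\<close>
lemma upper_half_plane_bound:
  assumes nz: "\<And>z. Im z \<ge> 0 \<Longrightarrow> poly p z \<noteq> 0" and z: "Im z \<ge> 0"
  shows "norm (lead_coeff p) * Im z ^ degree p \<le> norm (poly p z)"
proof -
  obtain root where root: "smult (lead_coeff p) (\<Prod>i<degree p. [:-root i, 1:]) = p"
    by (rule complex_poly_decompose')
  have P: "poly p w = lead_coeff p * (\<Prod>i<degree p. w - root i)" for w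
    by (subst root[symmetric]) (simp add: poly_prod)
  have neg: "Im (root i) < 0" if "i < degree p" for i
  proof (rule ccontr)
    assume "\<not> Im (root i) < 0"
    moreover have "poly p (root i) = 0" unfolding P using that by (auto intro!: prod_zero)
    ultimately show False using nz by force
  qed
  have "Im z ^ degree p = (\<Prod>i<degree p. Im z)" by simp
  also have "\<dots> \<le> (\<Prod>i<degree p. norm (z - root i))"
  proof (intro prod_mono conjI z)
    fix i assume "i \<in> {..<degree p}"
    then have "Im z \<le> Im (z - root i)" using neg by force
    also have "\<dots> \<le> norm (z - root i)" using abs_Im_le_cmod[of "z - root i"] by linarith
    finally show "Im z \<le> norm (z - root i)" .
  qed
  finally show ?thesis by (simp add: P norm_mult prod_norm mult_left_mono)
qed

lemma poly_map_of_real: "poly (map_poly complex_of_real p) (of_real x) = of_real (poly p x)"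
  by (induction p) (simp_all add: map_poly_pCons)

text \<open>Split off one real root at a time.\<close>
lemma real_rooted_nonreal_nonzero:
  fixes p :: "real poly"
  assumes "p \<noteq> 0" "size (proots p) = degree p" "Im z \<noteq> 0"
  shows "poly (map_poly of_real p) z \<noteq> 0"
  using assms(1,2)
proof (induction "degree p" arbitrary: p)
  case 0
  then obtain c where "p = [:c:]" "c \<noteq> 0" by (metis degree_eq_zeroE pCons_0_0)
  then show ?case by (simp add: map_poly_pCons)
next
  case (Suc n)
  then have "proots p \<noteq> {#}" by auto
  then obtain r where "r \<in># proots p" by blast
  then have "poly p r = 0" using Suc.prems by simp
  then obtain q where q: "p = [:-r, 1:] * q" by (auto simp: poly_eq_0_iff_dvd)
  then have "q \<noteq> 0" using Suc.prems by auto
  have "degree p = Suc (degree q)" unfolding q using \<open>q \<noteq> 0\<close> by (subst degree_mult_eq) auto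
  moreover have "proots p = {#r#} + proots q" unfolding q using \<open>q \<noteq> 0\<close> by (subst proots_mult) auto
  ultimately have IH: "poly (map_poly of_real q) z \<noteq> 0"
    using Suc.hyps(1)[of q] Suc.hyps(2) Suc.prems(2) \<open>q \<noteq> 0\<close> by simp
  define P where "P = [:-of_real r, 1:] * (map_poly of_real q :: complex poly)"
  have "map_poly of_real p = P"
    by (rule poly_eq_if_eq_on_reals) (simp add: P_def q poly_map_of_real algebra_simps)
  moreover have "z \<noteq> of_real r" using assms(3) by auto
  ultimately show ?case using IH by (simp add: P_def)
qed

lemma open_forall_compact:
  assumes "compact K" "open W"
  shows "open {x. {x} \<times> K \<subseteq> W}"
proof (subst open_subopen, intro ballI)
  fix x assume "x \<in> {x. {x} \<times> K \<subseteq> W}"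
  then obtain X where "x \<in> X" "open X" "X \<times> K \<subseteq> W"
    using Elementary_Topology.tube_lemma[OF assms, of x] by blast
  then show "\<exists>T. open T \<and> x \<in> T \<and> T \<subseteq> {x. {x} \<times> K \<subseteq> W}" by (intro exI[of _ X]) auto
qed

section \<open>Hyperbolic directions\<close>

locale complexified_form =
  fixes g :: "'a::euclidean_space \<Rightarrow> real" and G :: "'a \<times> 'a \<Rightarrow> complex" and N :: nat
  assumes G_real: "G (x, 0) = of_real (g x)"
    and G_cont: "continuous_on UNIV G"
    and G_line: "\<exists>p. \<forall>z. poly p z = G (X + cscale z D)"
    and g_homog: "g (t *\<^sub>R x) = t ^ N * g x"
    and N_pos: "N \<ge> 1"
begin

text \<open>Both sides are polynomials in \<open>w\<close> along \<open>x + w y\<close> and agree for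
  real \<open>w\<close>, hence also for \<open>w = \<i>\<close>.\<close>
lemma G_scaleR: "G (t *\<^sub>R X) = of_real t ^ N * G X"
proof -
  obtain x y where X: "X = (x, y)" by force
  obtain p where p: "\<And>z. poly p z = G ((x, 0) + cscale z (y, 0))" using G_line by blast
  obtain q where q: "\<And>z. poly q z = G ((t *\<^sub>R x, 0) + cscale z (t *\<^sub>R y, 0))" using G_line by blast
  have "q = smult (of_real t ^ N) p"
  proof (rule poly_eq_if_eq_on_reals)
    fix s :: real
    have "poly q (of_real s) = of_real (g (t *\<^sub>R (x + s *\<^sub>R y)))"
      unfolding q cscale_of_real by (simp add: G_real scaleR_add_right mult.commute)
    also have "\<dots> = of_real t ^ N * of_real (g (x + s *\<^sub>R y))" by (simp add: g_homog)
    finally show "poly q (of_real s) = poly (smult (of_real t ^ N) p) (of_real s)"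
      by (simp add: p cscale_of_real G_real)
  qed
  then have "poly q \<i> = of_real t ^ N * poly p \<i>" by simp
  then show ?thesis by (simp add: p q cscale_def X)
qed

lemma G_cscale: "G (cscale z X) = z ^ N * G X"
proof -
  obtain p where p: "\<And>z. poly p z = G (0 + cscale z X)" using G_line by blast
  have "p = monom (G X) N"
    by (rule poly_eq_if_eq_on_reals) (simp add: p cscale_of_real G_scaleR poly_monom)
  then have "poly p z = poly (monom (G X) N) z" by simp
  then show ?thesis by (simp add: p poly_monom)
qed

lemma G_line_degree:
  assumes "G D \<noteq> 0"
  obtains p where "\<And>z. poly p z = G (X + cscale z D)" "degree p = N" "lead_coeff p = G D"
proof -
  obtain p where p: "\<And>z. poly p z = G (X + cscale z D)" using G_line by blast
  obtain q where q: "\<And>z. poly q z = G (D + cscale z X)" using G_line by blast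
  have "degree p = N \<and> lead_coeff p = poly q 0"
  proof (rule degree_of_reversed_poly)
    fix z :: complex assume z: "z \<noteq> 0"
    have "X + cscale z D = cscale z (D + cscale (inverse z) X)"
      using z by (simp add: cscale_add_right cscale_cscale add.commute)
    then show "poly p z = z ^ N * poly q (inverse z)" by (simp add: p q G_cscale)
  qed (simp add: q assms)
  then have "degree p = N" and lead: "lead_coeff p = poly q 0" by blast+
  moreover have "lead_coeff p = G D" unfolding lead q by simp
  ultimately show thesis using that p by blast
qed

text \<open>Equivalent to the usual condition that \<open>t \<mapsto> g (t a + v)\<close> has only real
  roots, when \<open>g a \<noteq> 0\<close>; the number of roots with multiplicity is then the degree, by
  the fundamental theorem of algebra.\<close>
definition hyperbolic :: "'a \<Rightarrow> bool" where
  "hyperbolic a \<longleftrightarrow> (\<forall>v z. Im z \<noteq> 0 \<longrightarrow> G ((v, 0) + cscale z (a, 0)) \<noteq> 0)"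

lemma hyperbolicI:
  assumes a: "g a \<noteq> 0"
    and p: "\<And>v. \<exists>p. (\<forall>t. poly p t = g (t *\<^sub>R a + v)) \<and> p \<noteq> 0 \<and> size (proots p) = N"
  shows "hyperbolic a"
  unfolding hyperbolic_def
proof (intro allI impI)
  fix v and z :: complex assume z: "Im z \<noteq> 0"
  obtain p where p: "\<And>t. poly p t = g (t *\<^sub>R a + v)" "p \<noteq> 0" "size (proots p) = N" using p by blast
  obtain P where P: "\<And>z. poly P z = G ((v, 0) + cscale z (a, 0))" "degree P = N"
    using G_line_degree[of "(a, 0)" "(v, 0)"] a by (auto simp: G_real)
  have "map_poly of_real p = P"
    by (rule poly_eq_if_eq_on_reals)
      (simp add: P p poly_map_of_real cscale_of_real G_real add.commute)
  moreover have "degree (map_poly complex_of_real p) = degree p" by (rule degree_map_poly) simp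
  ultimately have "poly P z \<noteq> 0" using real_rooted_nonreal_nonzero[OF p(2) _ z] p(3) P(2) by metis
  then show "G ((v, 0) + cscale z (a, 0)) \<noteq> 0" by (simp add: P)
qed

lemma hyperbolic_factorization:
  assumes "hyperbolic a" "g a \<noteq> 0"
  obtains l :: "nat \<Rightarrow> real" where
    "\<And>z. G ((v, 0) + cscale z (a, 0)) = of_real (g a) * (\<Prod>i<N. z - of_real (l i))"
    "\<And>t. g (v + t *\<^sub>R a) = g a * (\<Prod>i<N. t - l i)"
proof -
  obtain p where p: "\<And>z. poly p z = G ((v, 0) + cscale z (a, 0))" "degree p = N" "lead_coeff p = G (a, 0)"
    using G_line_degree[of "(a, 0)" "(v, 0)"] assms by (auto simp: G_real)
  obtain root where root: "smult (lead_coeff p) (\<Prod>i<degree p. [:-root i, 1:]) = p"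
    by (rule complex_poly_decompose')
  have P: "poly p w = of_real (g a) * (\<Prod>i<N. w - root i)" for w
  proof -
    have "poly p w = lead_coeff p * (\<Prod>i<degree p. w - root i)"
      by (subst root[symmetric]) (simp add: poly_prod)
    then show ?thesis unfolding p(3) unfolding p(2) G_real .
  qed
  have real: "root i = of_real (Re (root i))" if "i < N" for i
  proof -
    have "poly p (root i) = 0" unfolding P using that by (auto intro!: prod_zero)
    then have "Im (root i) = 0" using assms(1) p(1) unfolding hyperbolic_def by metis
    then show ?thesis by (simp add: complex_eq_iff)
  qed
  have 1: "G ((v, 0) + cscale z (a, 0)) = of_real (g a) * (\<Prod>i<N. z - of_real (Re (root i)))" for z
    unfolding p(1)[symmetric] P using real by (intro arg_cong2[where f = "(*)"] prod.cong) auto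
  have 2: "g (v + t *\<^sub>R a) = g a * (\<Prod>i<N. t - Re (root i))" for t
  proof -
    have "complex_of_real (g (v + t *\<^sub>R a)) = of_real (g a * (\<Prod>i<N. t - Re (root i)))"
      using 1[of "of_real t"] by (simp add: cscale_of_real G_real)
    then show ?thesis using of_real_eq_iff by blast
  qed
  show thesis by (rule that[of "\<lambda>i. Re (root i)", OF 1 2])
qed

lemma g_cont: "continuous_on UNIV g"
proof -
  have "continuous_on UNIV (\<lambda>x. Re (G (x, 0)))"
    by (intro continuous_intros continuous_on_compose2[OF G_cont]) auto
  then show ?thesis by (simp add: G_real)
qed

text \<open>For a hyperbolic direction \<open>e\<close> with \<open>g e > 0\<close>, the Garding cone in
  terms of roots: the points \<open>x\<close> for which all roots of \<open>t \<mapsto> g (x + t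
  e)\<close> are negative.\<close>
definition ray_cone :: "'a \<Rightarrow> 'a set" where
  "ray_cone e = {x. \<forall>t\<ge>0. g (x + t *\<^sub>R e) > 0}"

lemma ray_cone_negative_roots:
  assumes e: "hyperbolic e" "g e > 0" and x: "x \<in> ray_cone e"
  shows "\<exists>l :: nat \<Rightarrow> real.
    (\<forall>z. G ((x, 0) + cscale z (e, 0)) = of_real (g e) * (\<Prod>i<N. z - of_real (l i))) \<and>
    (\<forall>t. g (x + t *\<^sub>R e) = g e * (\<Prod>i<N. t - l i)) \<and> (\<forall>i<N. l i < 0)"
proof -
  obtain l where l: "\<And>z. G ((x, 0) + cscale z (e, 0)) = of_real (g e) * (\<Prod>i<N. z - of_real (l i))"
    "\<And>t. g (x + t *\<^sub>R e) = g e * (\<Prod>i<N. t - l i)"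
    using hyperbolic_factorization[OF e(1), of x] e(2) by (metis less_irrefl)
  have "l i < 0" if "i < N" for i
  proof (rule ccontr)
    assume "\<not> l i < 0"
    then have "g (x + l i *\<^sub>R e) > 0" using x by (simp add: ray_cone_def)
    moreover have "(\<Prod>j<N. l i - l j) = 0" using that by (auto intro!: prod_zero)
    ultimately show False by (simp add: l)
  qed
  then show ?thesis using l by (intro exI[of _ l]) simp
qed

text \<open>All factors \<open>t - l i\<close> are positive and increase with \<open>t\<close>.\<close>
lemma ray_cone_monotone:
  assumes e: "hyperbolic e" "g e > 0" and x: "x \<in> ray_cone e" and t: "t \<ge> 0"
  shows "g x \<le> g (x + t *\<^sub>R e)"
proof -
  obtain l where l: "\<And>t. g (x + t *\<^sub>R e) = g e * (\<Prod>i<N. t - l i)" and neg: "\<And>i. i < N \<Longrightarrow> l i < 0"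
    using ray_cone_negative_roots[OF e x] by auto
  have "(\<Prod>i<N. 0 - l i) \<le> (\<Prod>i<N. t - l i)"
    using neg t by (intro prod_mono) (auto simp: less_imp_le)
  then have "g (x + 0 *\<^sub>R e) \<le> g (x + t *\<^sub>R e)" unfolding l using e(2) by (intro mult_left_mono) auto
  then show ?thesis by simp
qed

text \<open>By homogeneity, being positive on the ray from \<open>x\<close> in the direction
  \<open>e\<close> is the same as being positive on the segment from \<open>x\<close> to
  \<open>e\<close>. Compactness of the segment then shows that the ray cone is open.\<close>
lemma ray_cone_eq:
  assumes e: "g e > 0"
  shows "ray_cone e = {x. \<forall>s\<in>{0..1}. g (s *\<^sub>R x + (1 - s) *\<^sub>R e) > 0}"
proof (intro set_eqI iffI CollectI ballI)
  fix x and s :: real assume x: "x \<in> ray_cone e" and s: "s \<in> {0..1}"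
  show "g (s *\<^sub>R x + (1 - s) *\<^sub>R e) > 0"
  proof (cases "s = 0")
    case False
    then have s0: "s > 0" using s by simp
    have "s *\<^sub>R x + (1 - s) *\<^sub>R e = s *\<^sub>R (x + ((1 - s) / s) *\<^sub>R e)"
      using s0 by (simp add: scaleR_add_right)
    moreover have "g (x + ((1 - s) / s) *\<^sub>R e) > 0" using x s s0 by (simp add: ray_cone_def)
    ultimately show ?thesis using s0 by (simp add: g_homog)
  qed (use e in simp)
next
  fix x assume x: "x \<in> {x. \<forall>s\<in>{0..1}. g (s *\<^sub>R x + (1 - s) *\<^sub>R e) > 0}"
  have "g (x + t *\<^sub>R e) > 0" if t: "t \<ge> 0" for t
  proof -
    define s where "s = 1 / (1 + t)"
    have s: "s \<in> {0..1}" "s > 0" "1 - s = s * t" using t by (auto simp: s_def field_simps)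
    have "g (s *\<^sub>R x + (1 - s) *\<^sub>R e) > 0" using x s(1) by blast
    also have "s *\<^sub>R x + (1 - s) *\<^sub>R e = s *\<^sub>R (x + t *\<^sub>R e)" by (simp add: s(3) scaleR_add_right)
    finally show ?thesis using s(2) by (simp add: g_homog zero_less_mult_iff)
  qed
  then show "x \<in> ray_cone e" by (simp add: ray_cone_def)
qed



lemma open_ray_cone:
  assumes e: "g e > 0"
  shows "open (ray_cone e)"
proof -
  define W where "W = {p :: 'a \<times> real. g (snd p *\<^sub>R fst p + (1 - snd p) *\<^sub>R e) > 0}"
  have "open W" unfolding W_def
    by (intro open_Collect_less continuous_intros continuous_on_compose2[OF g_cont]) auto
  moreover have "ray_cone e = {x. {x} \<times> {0..1} \<subseteq> W}"
    unfolding ray_cone_eq[OF e] by (auto simp: W_def)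
  ultimately show ?thesis using open_forall_compact[OF compact_Icc] by simp
qed

text \<open>The monotonicity inequality passes to limits and keeps the ray away from the zero set,
  provided that \<open>g x > 0\<close>.\<close>
lemma ray_cone_closed_in_positive:
  assumes e: "hyperbolic e" "g e > 0" and x: "x \<in> closure (ray_cone e)" "g x > 0"
  shows "x \<in> ray_cone e"
proof -
  have "g x \<le> g (x + t *\<^sub>R e)" if t: "t \<ge> 0" for t
  proof -
    have "closure (ray_cone e) \<subseteq> {x. g x \<le> g (x + t *\<^sub>R e)}"
    proof (rule closure_minimal)
      show "closed {x. g x \<le> g (x + t *\<^sub>R e)}"
        by (intro closed_Collect_le continuous_intros continuous_on_compose2[OF g_cont]) auto
    qed (use ray_cone_monotone[OF e _ t] in auto)
    then show ?thesis using x(1) by blast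
  qed
  then show ?thesis using x(2) by (force simp: ray_cone_def)
qed

text \<open>Relative to the set \<open>g > 0\<close> the ray cone is open and closed, and it contains \<open>e\<close>, so it
  contains the whole component.\<close>
lemma component_subset_ray_cone:
  assumes \<Gamma>: "\<Gamma> \<in> components {x. g x > 0}" and e: "hyperbolic e" "e \<in> \<Gamma>"
  shows "\<Gamma> \<subseteq> ray_cone e"
proof -
  have pos: "g x > 0" if "x \<in> \<Gamma>" for x using in_components_subset[OF \<Gamma>] that by auto
  have ge: "g e > 0" by (rule pos[OF e(2)])
  have "openin (top_of_set \<Gamma>) (\<Gamma> \<inter> ray_cone e)"
    by (intro openin_open_Int open_ray_cone ge)
  moreover have "closedin (top_of_set \<Gamma>) (\<Gamma> \<inter> ray_cone e)"
  proof -
    have "\<Gamma> \<inter> ray_cone e = \<Gamma> \<inter> closure (ray_cone e)"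
      using ray_cone_closed_in_positive[OF e(1) ge] pos closure_subset[of "ray_cone e"] by blast
    then show ?thesis by (metis closedin_closed_Int closed_closure)
  qed
  moreover have "e \<in> ray_cone e"
  proof -
    have "g (e + t *\<^sub>R e) > 0" if "t \<ge> 0" for t
    proof -
      have "e + t *\<^sub>R e = (1 + t) *\<^sub>R e" by (simp add: scaleR_add_left)
      then show ?thesis using ge that by (simp add: g_homog)
    qed
    then show ?thesis by (simp add: ray_cone_def)
  qed
  ultimately have "\<Gamma> \<inter> ray_cone e = \<Gamma>"
    using in_components_connected[OF \<Gamma>] e(2) unfolding connected_clopen by blast
  then show ?thesis by blast
qed

text \<open>Deform \<open>v\<close> to \<open>0\<close> through \<open>\<tau> v\<close> and let
  \<open>T\<close> be the set of those \<open>\<tau>\<close> for which no root \<open>s\<close> lies in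
  the closed upper half plane. For \<open>\<tau> = 0\<close> the roots are \<open>\<i> /
  l\<^sub>i\<close> with \<open>l\<^sub>i < 0\<close>. Real roots never occur, by hyperbolicity of
  \<open>e\<close>; together with the lower bound for nonreal \<open>s\<close> this makes
  \<open>T\<close> closed. It is open because roots cannot come in from infinity, the leading coefficient
  being \<open>g a\<close>. By connectedness \<open>T\<close> is the whole line.\<close>
lemma upper_half_plane_estimate:
  fixes e a v :: 'a
  assumes e: "hyperbolic e" "g e > 0" and a: "a \<in> ray_cone e" and s: "Im s \<ge> 0"
  shows "norm (G ((v, 0) + cscale \<i> (e, 0) + cscale s (a, 0))) \<ge> g a * Im s ^ N"
proof -
  have "g (a + 0 *\<^sub>R e) > 0" using a unfolding ray_cone_def by blast
  then have ga: "g a > 0" by simp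
  define Q where "Q = (\<lambda>\<tau> s. G ((\<tau> *\<^sub>R v, 0) + cscale \<i> (e, 0) + cscale s (a, 0)))"
  have real: "Q \<tau> (of_real s) \<noteq> 0" for \<tau> s
  proof -
    have "Q \<tau> (of_real s) = G ((\<tau> *\<^sub>R v + s *\<^sub>R a, 0) + cscale \<i> (e, 0))"
      by (simp add: Q_def cscale_of_real cscale_def)
    then show ?thesis using e(1) unfolding hyperbolic_def by simp
  qed
  define T where "T = {\<tau>. \<forall>s. Im s \<ge> 0 \<longrightarrow> Q \<tau> s \<noteq> 0}"
  have bound: "norm (Q \<tau> s) \<ge> g a * Im s ^ N" if \<tau>: "\<tau> \<in> T" and s: "Im s \<ge> 0" for \<tau> s
  proof -
    obtain p where p: "\<And>s. poly p s = Q \<tau> s" "degree p = N" "lead_coeff p = G (a, 0)"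
      using G_line_degree[of "(a, 0)" "(\<tau> *\<^sub>R v, 0) + cscale \<i> (e, 0)"] ga
      unfolding Q_def by (auto simp: G_real)
    have "norm (lead_coeff p) * Im s ^ degree p \<le> norm (poly p s)"
      using \<tau> by (intro upper_half_plane_bound s) (auto simp: T_def p(1))
    then show ?thesis unfolding p(3) unfolding p(1,2) G_real using ga by simp
  qed
  have Qcont: "continuous_on UNIV (\<lambda>x. Q (fst x) (snd x))"
    unfolding Q_def by (intro continuous_intros continuous_on_compose2[OF G_cont]) auto
  have "closed T"
  proof (subst closure_subset_eq[symmetric], rule subsetI)
    fix \<tau> assume \<tau>: "\<tau> \<in> closure T"
    have "Q \<tau> s \<noteq> 0" if s: "Im s \<ge> 0" for s
    proof (cases "Im s = 0")
      case True
      then have "s = of_real (Re s)" by (simp add: complex_eq_iff)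
      then show ?thesis using real by metis
    next
      case False
      have "closure T \<subseteq> {\<tau>. norm (Q \<tau> s) \<ge> g a * Im s ^ N}"
      proof (rule closure_minimal)
        have "continuous_on UNIV (\<lambda>\<tau>. Q \<tau> s)"
          using continuous_on_compose2[OF Qcont, of UNIV "\<lambda>\<tau>. (\<tau>, s)"] by (simp add: continuous_intros)
        then show "closed {\<tau>. norm (Q \<tau> s) \<ge> g a * Im s ^ N}"
          by (intro closed_Collect_le continuous_intros)
      qed (use bound s in auto)
      then have "norm (Q \<tau> s) \<ge> g a * Im s ^ N" using \<tau> by blast
      moreover have "g a * Im s ^ N > 0" using ga s False by simp
      ultimately show ?thesis by auto
    qed
    then show "\<tau> \<in> T" by (simp add: T_def)
  qed
  moreover have "open T"
  proof -
    \<comment> \<open>In the coordinate \<open>w = 1 / s\<close> the point at infinity becomes \<open>w =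
      0\<close>, where the form takes the value \<open>g a\<close>; the two closed half disks
      \<open>K1\<close> and \<open>K2\<close> then cover the compactified half plane.\<close>
    define R where "R = (\<lambda>\<tau> w. G (cscale w ((\<tau> *\<^sub>R v, 0) + cscale \<i> (e, 0)) + (a, 0)))"
    have Rcont: "continuous_on UNIV (\<lambda>x. R (fst x) (snd x))"
      unfolding R_def by (intro continuous_intros continuous_on_compose2[OF G_cont]) auto
    have QR: "Q \<tau> s = s ^ N * R \<tau> (inverse s)" if "s \<noteq> 0" for \<tau> s
    proof -
      have "(\<tau> *\<^sub>R v, 0) + cscale \<i> (e, 0) + cscale s (a, 0) =
          cscale s (cscale (inverse s) ((\<tau> *\<^sub>R v, 0) + cscale \<i> (e, 0)) + (a, 0))"
        using that by (simp add: cscale_add_right cscale_cscale flip: mult.assoc)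
      then show ?thesis by (simp add: Q_def R_def G_cscale)
    qed
    define K1 where "K1 = cball (0::complex) 1 \<inter> {s. Im s \<ge> 0}"
    define K2 where "K2 = cball (0::complex) 1 \<inter> {w. Im w \<le> 0}"
    have K: "compact K1" "compact K2" unfolding K1_def K2_def
      by (intro compact_Int_closed compact_cball closed_halfspace_Im_ge closed_halfspace_Im_le)+
    define W1 where "W1 = {x. Q (fst x) (snd x) \<noteq> 0}"
    define W2 where "W2 = {x. R (fst x) (snd x) \<noteq> 0}"
    have W: "open W1" "open W2" unfolding W1_def W2_def
      using Qcont Rcont by (auto intro: open_Collect_neq continuous_on_const)
    have "T = {\<tau>. {\<tau>} \<times> K1 \<subseteq> W1} \<inter> {\<tau>. {\<tau>} \<times> K2 \<subseteq> W2}"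
    proof (intro set_eqI iffI)
      fix \<tau> assume \<tau>: "\<tau> \<in> T"
      have "R \<tau> w \<noteq> 0" if w: "w \<in> K2" for w
      proof (cases "w = 0")
        case True
        then show ?thesis using ga by (simp add: R_def G_real)
      next
        case False
        have "Im (inverse w) \<ge> 0" using w by (simp add: K2_def divide_nonpos_nonneg)
        then have "Q \<tau> (inverse w) \<noteq> 0" using \<tau> by (simp add: T_def)
        then show ?thesis using QR[of "inverse w" \<tau>] False by auto
      qed
      then show "\<tau> \<in> {\<tau>. {\<tau>} \<times> K1 \<subseteq> W1} \<inter> {\<tau>. {\<tau>} \<times> K2 \<subseteq> W2}"
        using \<tau> by (auto simp: T_def W1_def W2_def K1_def)
    next
      fix \<tau> assume \<tau>: "\<tau> \<in> {\<tau>. {\<tau>} \<times> K1 \<subseteq> W1} \<inter> {\<tau>. {\<tau>} \<times> K2 \<subseteq> W2}"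
      have "Q \<tau> s \<noteq> 0" if s: "Im s \<ge> 0" for s
      proof (cases "norm s \<le> 1")
        case True
        then have "s \<in> K1" using s by (simp add: K1_def)
        then show ?thesis using \<tau> by (auto simp: W1_def)
      next
        case False
        then have s0: "s \<noteq> 0" by auto
        have "norm (inverse s) \<le> 1" using False by (simp add: norm_inverse inverse_le_1_iff)
        then have "inverse s \<in> K2" using s by (simp add: K2_def)
        then have "R \<tau> (inverse s) \<noteq> 0" using \<tau> by (auto simp: W2_def)
        then show ?thesis using QR[OF s0] s0 by simp
      qed
      then show "\<tau> \<in> T" by (simp add: T_def)
    qed
    then show ?thesis using open_forall_compact K W by (metis open_Int)
  qed
  moreover have "0 \<in> T"
  proof -
    obtain l where l: "\<And>z. G ((a, 0) + cscale z (e, 0)) = of_real (g e) * (\<Prod>i<N. z - of_real (l i))"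
      and neg: "\<And>i. i < N \<Longrightarrow> l i < 0"
      using ray_cone_negative_roots[OF e a] by auto
    have "Q 0 s \<noteq> 0" if s: "Im s \<ge> 0" for s
    proof (cases "Im s = 0")
      case True
      then have "s = of_real (Re s)" by (simp add: complex_eq_iff)
      then show ?thesis using real by metis
    next
      case False
      then have s0: "s \<noteq> 0" by auto
      have "(0 *\<^sub>R v, 0) + cscale \<i> (e, 0) + cscale s (a, 0) = cscale s ((a, 0) + cscale (\<i> / s) (e, 0))"
        using s0 by (simp add: cscale_add_right cscale_cscale add.commute flip: zero_prod_def)
      then have Q0: "Q 0 s = s ^ N * (of_real (g e) * (\<Prod>i<N. \<i> / s - of_real (l i)))"
        by (simp add: Q_def G_cscale l)
      have "\<i> / s \<noteq> of_real (l i)" if "i < N" for i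
      proof
        assume "\<i> / s = of_real (l i)"
        then have "\<i> = s * of_real (l i)" using s0 by (simp add: field_simps)
        then have "Im \<i> = Im (s * of_real (l i))" by (rule arg_cong)
        then have "1 = Im s * l i" by simp
        moreover have "Im s * l i \<le> 0" using s neg[OF that] by (intro mult_nonneg_nonpos) auto
        ultimately show False by simp
      qed
      then show ?thesis unfolding Q0 using s0 e(2) by simp
    qed
    then show ?thesis by (simp add: T_def)
  qed
  ultimately have "T = UNIV" using clopen[of T] by auto
  then have "1 \<in> T" by blast
  then show ?thesis using bound[of 1 s] s by (simp add: Q_def)
qed

text \<open>The preceding estimate, rescaled, bounds \<open>g (v + \<i> \<mu> e + s a)\<close> from below
  uniformly in \<open>\<mu> > 0\<close>. Letting \<open>\<mu>\<close> tend to \<open>0\<close> excludes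
  roots in the upper half plane, and the reflection \<open>v + z a = - (- v - z a)\<close> excludes those
  in the lower one.\<close>
lemma ray_cone_hyperbolic:
  fixes e a :: 'a
  assumes e: "hyperbolic e" "g e > 0" and a: "a \<in> ray_cone e"
  shows "hyperbolic a"
proof -
  have "g (a + 0 *\<^sub>R e) > 0" using a unfolding ray_cone_def by blast
  then have ga: "g a > 0" by simp
  have upper: "G ((v, 0) + cscale s (a, 0)) \<noteq> 0" if s: "Im s > 0" for v s
  proof -
    have bound: "norm (G ((v, 0) + cscale (\<i> * of_real \<mu>) (e, 0) + cscale s (a, 0))) \<ge> g a * Im s ^ N"
      if \<mu>: "\<mu> > 0" for \<mu> :: real
    proof -
      define X where "X = (inverse \<mu> *\<^sub>R v, 0) + cscale \<i> (e, 0) + cscale (s / of_real \<mu>) (a, 0)"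
      have "(v, 0) + cscale (\<i> * of_real \<mu>) (e, 0) + cscale s (a, 0) = \<mu> *\<^sub>R X"
        unfolding X_def cscale_of_real[symmetric] cscale_add_right cscale_cscale
        using \<mu> by (simp add: cscale_of_real mult.commute)
      then have "norm (G ((v, 0) + cscale (\<i> * of_real \<mu>) (e, 0) + cscale s (a, 0))) = \<mu> ^ N * norm (G X)"
        using \<mu> by (simp add: G_scaleR norm_mult norm_power)
      moreover have "norm (G X) \<ge> g a * Im (s / of_real \<mu>) ^ N"
        unfolding X_def using s \<mu> by (intro upper_half_plane_estimate[OF e a]) simp
      then have "\<mu> ^ N * norm (G X) \<ge> \<mu> ^ N * (g a * (Im s / \<mu>) ^ N)"
        using \<mu> by (intro mult_left_mono) auto
      moreover have "\<mu> ^ N * (g a * (Im s / \<mu>) ^ N) = g a * Im s ^ N" using \<mu> by (simp add: power_divide)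
      ultimately show ?thesis by simp
    qed
    have cont: "continuous_on UNIV (\<lambda>\<mu>. norm (G ((v, 0) + cscale (\<i> * of_real \<mu>) (e, 0) + cscale s (a, 0))))"
      by (intro continuous_intros continuous_on_compose2[OF G_cont]) auto
    have "closure {0<..} \<subseteq> {\<mu>. norm (G ((v, 0) + cscale (\<i> * of_real \<mu>) (e, 0) + cscale s (a, 0))) \<ge> g a * Im s ^ N}"
      using bound by (intro closure_minimal closed_Collect_le cont continuous_on_const) auto
    moreover have "0 \<in> closure {0::real<..}" by simp
    ultimately have "norm (G ((v, 0) + cscale (\<i> * of_real 0) (e, 0) + cscale s (a, 0))) \<ge> g a * Im s ^ N"
      by blast
    moreover have "g a * Im s ^ N > 0" using ga s by simp
    ultimately show ?thesis by auto
  qed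
  have "G ((v, 0) + cscale z (a, 0)) \<noteq> 0" if z: "Im z < 0" for v z
  proof -
    have "(v, 0) + cscale z (a, 0) = (-1) *\<^sub>R ((-v, 0) + cscale (-z) (a, 0))" by (simp add: cscale_def)
    then have "G ((v, 0) + cscale z (a, 0)) = of_real (-1) ^ N * G ((-v, 0) + cscale (-z) (a, 0))"
      by (simp only: G_scaleR)
    moreover have "G ((-v, 0) + cscale (-z) (a, 0)) \<noteq> 0" using upper[of "-z" "-v"] z by simp
    ultimately show ?thesis by simp
  qed
  then show ?thesis unfolding hyperbolic_def using upper by (metis linorder_neqE_linordered_idom)
qed


end

section \<open>Convexity of the cone and concavity of the logarithm\<close>

text \<open>With \<open>m = 1 - t l\<close>, the inequality \<open>ln u \<le> u - 1\<close> at \<open>u =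
  1 / m\<close> and \<open>u = (1 - l) / m\<close>, whose mean with weights \<open>1 - t\<close> and
  \<open>t\<close> is \<open>1\<close>.\<close>
lemma ln_linear_strict_concave:
  fixes l t :: real
  assumes "l < 1" "0 < t" "t < 1"
  shows "t * ln (1 - l) \<le> ln (1 - t * l)" and "l \<noteq> 0 \<Longrightarrow> t * ln (1 - l) < ln (1 - t * l)"
proof -
  define m where "m = 1 - t * l"
  have "t * l < 1"
  proof (cases "l \<le> 0")
    case True
    then show ?thesis using assms(2) mult_nonneg_nonpos[of t l] by linarith
  next
    case False
    then have "t * l \<le> 1 * l" using assms by (intro mult_right_mono) auto
    then show ?thesis using assms(1) by simp
  qed
  then have m: "m > 0" by (simp add: m_def)
  have sum: "(1 - t) * (1 / m - 1) + t * ((1 - l) / m - 1) = 0"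
  proof -
    have "(1 - t) * (1 / m - 1) + t * ((1 - l) / m - 1) = (1 - t * l) / m - 1"
      using m by (simp add: field_simps)
    then show ?thesis using m by (simp add: m_def)
  qed
  have diff: "t * ln (1 - l) - ln m = (1 - t) * ln (1 / m) + t * ln ((1 - l) / m)"
    using m assms by (simp add: ln_div algebra_simps)
  have le: "ln (1 / m) \<le> 1 / m - 1" "ln ((1 - l) / m) \<le> (1 - l) / m - 1"
    using m assms by (auto intro!: ln_le_minus_one)
  have t: "t * ln ((1 - l) / m) \<le> t * ((1 - l) / m - 1)" using le(2) assms by (intro mult_left_mono) auto
  have "(1 - t) * ln (1 / m) \<le> (1 - t) * (1 / m - 1)" using le(1) assms by (intro mult_left_mono) auto
  then show "t * ln (1 - l) \<le> ln (1 - t * l)" using diff t sum by (simp add: m_def)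
  assume "l \<noteq> 0"
  then have "1 / m \<noteq> 1" using assms by (simp add: m_def)
  then have "ln (1 / m) < 1 / m - 1" using le(1) ln_eq_minus_one[of "1 / m"] m by (auto simp: less_le)
  then have "(1 - t) * ln (1 / m) < (1 - t) * (1 / m - 1)" using assms by (intro mult_strict_left_mono) auto
  then show "t * ln (1 - l) < ln (1 - t * l)" using diff t sum by (simp add: m_def)
qed

locale hyperbolicity_cone = complexified_form +
  fixes \<Gamma> :: "'a set"
  assumes component: "\<Gamma> \<in> components {x. g x > 0}"
    and hyperbolic_point: "\<exists>e\<in>\<Gamma>. hyperbolic e"
begin

lemma positive: "x \<in> \<Gamma> \<Longrightarrow> g x > 0"
  using in_components_subset[OF component] by auto

lemma connected_positive_subset:
  assumes "connected S" "\<And>x. x \<in> S \<Longrightarrow> g x > 0" "x \<in> S" "x \<in> \<Gamma>"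
  shows "S \<subseteq> \<Gamma>"
  by (rule components_maximal[OF component]) (use assms in auto)

text \<open>Hyperbolicity at one point makes the component part of the ray cone of that point, all of
  whose points are hyperbolic.\<close>
lemma all_hyperbolic: "a \<in> \<Gamma> \<Longrightarrow> hyperbolic a"
  using hyperbolic_point ray_cone_hyperbolic component_subset_ray_cone[OF component] positive by blast

lemma subset_ray_cone: "a \<in> \<Gamma> \<Longrightarrow> \<Gamma> \<subseteq> ray_cone a"
  by (intro component_subset_ray_cone[OF component] all_hyperbolic)

lemma cone_open: "open \<Gamma>"
proof (rule openI)
  fix x assume x: "x \<in> \<Gamma>"
  have "open {x. g x > 0}" by (intro open_Collect_less continuous_on_const g_cont)
  then obtain r where r: "r > 0" "ball x r \<subseteq> {x. g x > 0}"
    using positive[OF x] open_contains_ball by blast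
  then have "ball x r \<subseteq> \<Gamma>" using x by (intro connected_positive_subset[of _ x]) auto
  then show "\<exists>r>0. ball x r \<subseteq> \<Gamma>" using r(1) by blast
qed

text \<open>Every point is hyperbolic, so the set is starlike about each of its points.\<close>
lemma cone_convex: "convex \<Gamma>"
  unfolding convex_contains_segment
proof (intro ballI)
  fix x y assume xy: "x \<in> \<Gamma>" "y \<in> \<Gamma>"
  have "g z > 0" if z: "z \<in> closed_segment x y" for z
  proof -
    obtain u where u: "0 \<le> u" "u \<le> 1" "z = (1 - u) *\<^sub>R x + u *\<^sub>R y" using z by (auto simp: in_segment)
    have "y \<in> ray_cone x" using subset_ray_cone xy by blast
    then have "g (u *\<^sub>R y + (1 - u) *\<^sub>R x) > 0" using u(1,2) unfolding ray_cone_eq[OF positive[OF xy(1)]] by auto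
    then show ?thesis by (simp add: u(3) add.commute)
  qed
  then show "closed_segment x y \<subseteq> \<Gamma>" using xy by (intro connected_positive_subset[of _ x]) auto
qed

lemma cone_scale:
  assumes "x \<in> \<Gamma>" "t > 0" shows "t *\<^sub>R x \<in> \<Gamma>"
proof -
  have "connected ((\<lambda>s. s *\<^sub>R x) ` {0<..})"
    by (intro connected_continuous_image continuous_intros) auto
  then have "(\<lambda>s. s *\<^sub>R x) ` {0<..} \<subseteq> \<Gamma>"
    using assms positive by (intro connected_positive_subset[of _ x]) (auto simp: g_homog intro!: image_eqI[of _ _ 1])
  then show ?thesis using assms by auto
qed

lemma open_convex_cone: "open_convex_cone \<Gamma>"
  unfolding open_convex_cone_def using cone_open cone_convex cone_scale by blast

lemma monotone: "x \<in> \<Gamma> \<Longrightarrow> z \<in> \<Gamma> \<Longrightarrow> g x \<le> g (x + z)"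
  using ray_cone_monotone[of z x 1] all_hyperbolic subset_ray_cone positive by fastforce

text \<open>By homogeneity \<open>w + s x\<close> lies in the cone for every \<open>s > 0\<close>; let
  \<open>s\<close> tend to \<open>0\<close>, for \<open>w = v\<close> and \<open>w = - v\<close>.\<close>
lemma line_in_edge:
  assumes x: "x \<in> \<Gamma>" and line: "\<And>t. x + t *\<^sub>R v \<in> \<Gamma>"
  shows "v \<in> edge \<Gamma>"
proof -
  have cl: "w \<in> closure \<Gamma>" if w: "\<And>t. x + t *\<^sub>R w \<in> \<Gamma>" for w
  proof -
    have mem: "w + s *\<^sub>R x \<in> \<Gamma>" if "s > 0" for s
    proof -
      have "s *\<^sub>R (x + inverse s *\<^sub>R w) \<in> \<Gamma>" using cone_scale[OF w that] .
      then show ?thesis using that by (simp add: scaleR_add_right add.commute)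
    qed
    have "closure {0<..} \<subseteq> (\<lambda>s. w + s *\<^sub>R x) -` closure \<Gamma>"
      using mem closure_subset[of \<Gamma>] by (intro closure_minimal closed_vimage continuous_intros) auto
    then show ?thesis by force
  qed
  have "v \<in> closure \<Gamma>" using cl line by blast
  moreover have "x + t *\<^sub>R (- v) \<in> \<Gamma>" for t using line[of "- t"] by simp
  then have "- v \<in> closure \<Gamma>" using cl by blast
  ultimately show ?thesis unfolding edge_def by (auto intro!: image_eqI[of _ _ "- v"])
qed

text \<open>On a segment the logarithm of \<open>g\<close> is a sum of functions \<open>ln (1 - t
  l\<^sub>i)\<close>. If none of them were strictly concave, \<open>g\<close> would be constant on the
  whole line, which would then stay in the cone and put its direction into the edge.\<close>
lemma strictly_concave_log:
  assumes edge: "edge \<Gamma> = {0}"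
  shows "strictly_concave_on \<Gamma> (\<lambda>x. ln (g x))"
proof -
  have "(1 - t) * ln (g x) + t * ln (g z) < ln (g ((1 - t) *\<^sub>R x + t *\<^sub>R z))"
    if x: "x \<in> \<Gamma>" and z: "z \<in> \<Gamma>" and xz: "x \<noteq> z" and t: "0 < t" "t < 1" for x z t
  proof -
    define v where "v = z - x"
    have gx: "g x > 0" by (rule positive[OF x])
    obtain l where l: "\<And>t. g (v + t *\<^sub>R x) = g x * (\<Prod>i<N. t - l i)"
      using hyperbolic_factorization[OF all_hyperbolic[OF x], of v] gx by (metis less_irrefl)
    have gv: "g (x + t *\<^sub>R v) = g x * (\<Prod>i<N. 1 - t * l i)" for t
    proof (cases "t = 0")
      case False
      then have "g (x + t *\<^sub>R v) = t ^ N * g (v + inverse t *\<^sub>R x)"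
        by (subst g_homog[symmetric]) (simp add: scaleR_add_right add.commute)
      also have "\<dots> = g x * (\<Prod>i<N. t * (inverse t - l i))" by (simp add: l prod.distrib)
      also have "\<dots> = g x * (\<Prod>i<N. 1 - t * l i)" using False by (simp add: right_diff_distrib)
      finally show ?thesis .
    qed simp
    have seg: "x + t *\<^sub>R v \<in> \<Gamma>" if "0 \<le> t" "t \<le> 1" for t
      using convexD_alt[OF cone_convex x z that] by (simp add: v_def algebra_simps)
    have l1: "l i < 1" if i: "i < N" for i
    proof (rule ccontr)
      assume li: "\<not> l i < 1"
      then have "x + inverse (l i) *\<^sub>R v \<in> \<Gamma>" by (intro seg) (auto simp: inverse_le_1_iff)
      then have "g (x + inverse (l i) *\<^sub>R v) > 0" by (rule positive)
      moreover have "(\<Prod>j<N. 1 - inverse (l i) * l j) = 0" using i li by (intro prod_zero bexI[of _ i]) auto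
      ultimately show False unfolding gv by simp
    qed
    have "\<exists>k<N. l k \<noteq> 0"
    proof (rule ccontr)
      assume "\<not> (\<exists>k<N. l k \<noteq> 0)"
      then have const: "g (x + t *\<^sub>R v) = g x" for t by (simp add: gv)
      have "connected (range (\<lambda>t::real. x + t *\<^sub>R v))"
        by (intro connected_continuous_image continuous_intros) auto
      then have "range (\<lambda>t::real. x + t *\<^sub>R v) \<subseteq> \<Gamma>"
        using const gx x by (intro connected_positive_subset[of _ x]) (auto intro!: image_eqI[of _ _ 0])
      then have "v \<in> edge \<Gamma>" using line_in_edge[OF x] by blast
      then show False using edge xz by (simp add: v_def)
    qed
    then obtain k where k: "k < N" "l k \<noteq> 0" by blast
    have lt1: "t * l i < 1" if "i < N" for i
    proof (cases "l i \<le> 0")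
      case True
      then show ?thesis using t mult_nonneg_nonpos[of t "l i"] by linarith
    next
      case False
      then have "t * l i \<le> 1 * l i" using t by (intro mult_right_mono) auto
      then show ?thesis using l1[OF that] by simp
    qed
    have lnv: "ln (g (x + s *\<^sub>R v)) = ln (g x) + (\<Sum>i<N. ln (1 - s * l i))"
      if "\<And>i. i < N \<Longrightarrow> s * l i < 1" for s
    proof -
      have "(\<Prod>i<N. 1 - s * l i) > 0" using that by (intro prod_pos) auto
      then have "ln (g (x + s *\<^sub>R v)) = ln (g x) + ln (\<Prod>i<N. 1 - s * l i)"
        unfolding gv using gx by (metis ln_mult_pos)
      also have "ln (\<Prod>i<N. 1 - s * l i) = (\<Sum>i<N. ln (1 - s * l i))"
      proof (rule ln_prod)
        show "1 - s * l i \<noteq> 0" if "i \<in> {..<N}" for i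
          using \<open>\<And>i. i < N \<Longrightarrow> s * l i < 1\<close>[of i] that by simp
      qed simp
      finally show ?thesis .
    qed
    have "(\<Sum>i<N. t * ln (1 - l i)) < (\<Sum>i<N. ln (1 - t * l i))"
      using ln_linear_strict_concave[OF l1 t] k by (intro sum_strict_mono_ex1) auto
    then have "t * (\<Sum>i<N. ln (1 - l i)) < (\<Sum>i<N. ln (1 - t * l i))" by (simp add: sum_distrib_left)
    moreover have "ln (g z) = ln (g x) + (\<Sum>i<N. ln (1 - l i))" using lnv[of 1] l1 by (simp add: v_def)
    moreover have "(1 - t) *\<^sub>R x + t *\<^sub>R z = x + t *\<^sub>R v" by (simp add: v_def algebra_simps)
    ultimately show ?thesis using lnv[of t] lt1 by (simp add: algebra_simps)
  qed
  then show ?thesis unfolding strictly_concave_on_def strictly_convex_on_def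
    using cone_convex by fastforce
qed

text \<open>A functional in the interior of the polar remains in the polar after subtracting a small
  multiple of the inner product with \<open>x / |x|\<close>.\<close>
lemma coercive_on_interior_polar:
  assumes y: "y \<in> interior (polar \<Gamma>)"
  obtains c where "c > 0" "\<And>x. x \<in> \<Gamma> \<Longrightarrow> blinfun_apply y x \<ge> c * norm x"
proof -
  obtain r where r: "r > 0" "ball y r \<subseteq> polar \<Gamma>" using y by (meson mem_interior)
  have "blinfun_apply y x \<ge> (r / 2) * norm x" if x: "x \<in> \<Gamma>" for x
  proof -
    define u where "u = sgn x"
    define w where "w = y - (r / 2) *\<^sub>R blinfun_inner_left u"
    have "norm (blinfun_inner_left u) \<le> 1"
    proof (rule norm_blinfun_bound)
      show "norm (blinfun_apply (blinfun_inner_left u) z) \<le> 1 * norm z" for z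
        using Cauchy_Schwarz_ineq2[of z u] mult_left_mono[of "norm u" 1 "norm z"]
        by (simp add: u_def norm_sgn split: if_splits)
    qed simp
    then have "norm (y - w) < r" using r(1) by (simp add: w_def)
    then have "w \<in> polar \<Gamma>" using r(2) by (auto simp: dist_norm)
    then have "blinfun_apply w x \<ge> 0" using x by (simp add: polar_def)
    moreover have "x \<bullet> u = norm x" by (cases "x = 0") (simp_all add: u_def sgn_div_norm dot_square_norm power2_eq_square)
    ultimately show ?thesis by (simp add: w_def blinfun.bilinear_simps)
  qed
  then show thesis using that[of "r / 2"] r(1) by simp
qed

text \<open>Written as \<open>exp (\<langle>y, x\<rangle> - k) \<le> g x\<close>, the condition stays
  away from the zeros of \<open>g\<close>, so the sublevel set is closed in the whole space; it is
  bounded because the left side grows exponentially on the cone and the right side like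
  \<open>|x|^N\<close>.\<close>
lemma sublevel_compact:
  assumes y: "y \<in> interior (polar \<Gamma>)"
  shows "compact {x \<in> \<Gamma>. blinfun_apply y x - ln (g x) \<le> k}"
proof -
  define S where "S = {x \<in> \<Gamma>. blinfun_apply y x - ln (g x) \<le> k}"
  obtain c where c: "c > 0" "\<And>x. x \<in> \<Gamma> \<Longrightarrow> blinfun_apply y x \<ge> c * norm x"
    using coercive_on_interior_polar[OF y] by blast
  have iff: "blinfun_apply y x - ln (g x) \<le> k \<longleftrightarrow> exp (blinfun_apply y x - k) \<le> g x" if "g x > 0" for x
    using that ln_ge_iff[of "g x" "blinfun_apply y x - k"] by linarith
  have "S = closure \<Gamma> \<inter> {x. exp (blinfun_apply y x - k) \<le> g x}"
  proof (intro set_eqI iffI)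
    fix x assume "x \<in> S"
    then show "x \<in> closure \<Gamma> \<inter> {x. exp (blinfun_apply y x - k) \<le> g x}"
      using iff positive closure_subset[of \<Gamma>] by (auto simp: S_def)
  next
    fix x assume x: "x \<in> closure \<Gamma> \<inter> {x. exp (blinfun_apply y x - k) \<le> g x}"
    then have gx: "g x > 0" by (auto intro: less_le_trans[OF exp_gt_zero])
    have "closedin (top_of_set {x. g x > 0}) \<Gamma>" by (rule closedin_component[OF component])
    then obtain T where T: "closed T" "\<Gamma> = {x. g x > 0} \<inter> T" unfolding closedin_closed by blast
    have "closure \<Gamma> \<subseteq> T" using T by (intro closure_minimal) auto
    then have "x \<in> \<Gamma>" using x gx T(2) by blast
    then show "x \<in> S" using x iff[OF gx] by (simp add: S_def)
  qed
  moreover have "closed {x. exp (blinfun_apply y x - k) \<le> g x}"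
    by (intro closed_Collect_le continuous_intros g_cont)
  ultimately have "closed S" by (simp add: closed_Int)
  moreover have "bounded S"
  proof -
    have "compact (g ` sphere 0 1)"
      by (intro compact_continuous_image compact_sphere continuous_on_subset[OF g_cont]) auto
    then obtain C where C: "C > 0" "\<And>u. norm u = 1 \<Longrightarrow> g u \<le> C"
      using compact_imp_bounded[THEN bounded_pos[THEN iffD1]] by (force simp: dist_norm)
    \<comment> \<open>Chosen so that \<open>u^N / exp u < \<delta>\<close> at \<open>u = c |x|\<close>
      contradicts \<open>exp (u - k) \<le> C |x|^N\<close>.\<close>
    define \<delta> where "\<delta> = c ^ N * exp (- k) / C"
    have "\<delta> > 0" using c(1) C(1) by (simp add: \<delta>_def)
    then have "eventually (\<lambda>u::real. u ^ N / exp u < \<delta>) at_top"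
      using order_tendstoD(2)[OF tendsto_power_div_exp_0] by blast
    then obtain U where U: "\<And>u. u \<ge> U \<Longrightarrow> u ^ N / exp u < \<delta>" by (auto simp: eventually_at_top_linorder)
    have "norm x \<le> U / c" if x: "x \<in> S" for x
    proof (rule ccontr)
      assume "\<not> norm x \<le> U / c"
      then have u: "c * norm x \<ge> U" using c(1) by (simp add: field_simps)
      have xG: "x \<in> \<Gamma>" and gx: "g x > 0" using x positive by (auto simp: S_def)
      have "g x \<le> C * norm x ^ N"
      proof (cases "x = 0")
        case True
        have "g 0 = 0" using g_homog[of 0 0] N_pos by (simp add: power_0_left)
        then show ?thesis using True gx by simp
      next
        case False
        have "g x = g (norm x *\<^sub>R sgn x)" using False by (simp add: sgn_div_norm)
        also have "\<dots> = norm x ^ N * g (sgn x)" by (rule g_homog)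
        also have "\<dots> \<le> norm x ^ N * C" using C(2)[of "sgn x"] False by (intro mult_left_mono) (auto simp: norm_sgn)
        finally show ?thesis by (simp add: mult.commute)
      qed
      moreover have "exp (blinfun_apply y x - k) \<le> g x" using x iff[OF gx] by (simp add: S_def)
      moreover have "exp (c * norm x) * exp (- k) \<le> exp (blinfun_apply y x - k)"
        using c(2)[OF xG] by (simp flip: exp_add)
      ultimately have "exp (c * norm x) * exp (- k) \<le> C * norm x ^ N" by linarith
      moreover have "(c * norm x) ^ N < \<delta> * exp (c * norm x)"
        using U[OF u] by (simp add: divide_less_eq)
      then have "C * (c ^ N * norm x ^ N) < c ^ N * exp (- k) * exp (c * norm x)"
        using C(1) by (simp add: \<delta>_def power_mult_distrib field_simps)
      then have "c ^ N * (C * norm x ^ N) < c ^ N * (exp (c * norm x) * exp (- k))" by (simp add: mult_ac)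
      then have "C * norm x ^ N < exp (c * norm x) * exp (- k)" using c(1) by simp
      ultimately show False by simp
    qed
    then show ?thesis by (rule boundedI)
  qed
  ultimately show ?thesis unfolding S_def[symmetric] by (simp add: compact_eq_bounded_closed)
qed

end

section \<open>The double dual of a pair\<close>

lemma garding_like_pair_legendre:
  assumes "garding_like_pair N g \<Gamma>"
  shows "legendre_cone g \<Gamma> N"
proof
  note G = assms[unfolded garding_like_pair_def]
  show "\<Gamma> \<noteq> {}" "open_convex_cone \<Gamma>" "strictly_concave_on \<Gamma> (\<lambda>x. ln (g x))" using G by blast+
  show "g x > 0" if "x \<in> \<Gamma>" for x using G that by blast
  show "g differentiable (at x)" if "x \<in> \<Gamma>" for x
    using G that real_analytic_imp_differentiable by blast
  show "g (t *\<^sub>R x) = t powr N * g x" if "x \<in> \<Gamma>" "t > 0" for x t using G that by blast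
  show "g x \<le> g (x + z)" if "x \<in> \<Gamma>" "z \<in> \<Gamma>" for x z using G that less_imp_le by blast
  show "compact {x \<in> \<Gamma>. blinfun_apply y x - ln (g x) \<le> c}" if "y \<in> open_polar \<Gamma>" for y c
    using G that by blast
qed

lemma garding_polynomial_hyperbolicity_cone:
  assumes "garding_polynomial N g \<Gamma>"
  obtains G where "hyperbolicity_cone g G N \<Gamma>"
proof -
  note P = assms[unfolded garding_polynomial_def]
  obtain G where G: "\<And>x. G (x, 0) = of_real (g x)" "continuous_on UNIV G"
    "\<And>X D. \<exists>p. \<forall>z. poly p z = G (X + cscale z D)"
    using real_polynomial_function_complexification[of g] P by blast
  interpret complexified_form g G N
    by unfold_locales (use P G in auto)
  obtain e where e: "e \<in> \<Gamma>" and
    p: "\<And>v. \<exists>p :: real poly. (\<forall>t. poly p t = g (t *\<^sub>R e + v)) \<and> p \<noteq> 0 \<and> size (proots p) = N"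
    using P by blast
  have comp: "\<Gamma> \<in> components {x. g x > 0}" using P by blast
  then have "g e > 0" using e in_components_subset by blast
  then have "hyperbolic e" by (intro hyperbolicI p) simp
  then have "hyperbolicity_cone g G N \<Gamma>"
    by unfold_locales (use comp e in auto)
  then show thesis by (rule that)
qed

lemma garding_polynomial_legendre:
  assumes P: "garding_polynomial N g \<Gamma>" and edge: "edge \<Gamma> = {0}"
  shows "legendre_cone g \<Gamma> (real N)"
proof -
  obtain G where "hyperbolicity_cone g G N \<Gamma>" by (rule garding_polynomial_hyperbolicity_cone[OF P])
  then interpret hyperbolicity_cone g G N \<Gamma> .
  interpret log_concave_cone g \<Gamma> "real N"
  proof
    show "\<Gamma> \<noteq> {}" using hyperbolic_point by blast
    show "open_convex_cone \<Gamma>" by (rule open_convex_cone)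
    show "g x > 0" if "x \<in> \<Gamma>" for x using positive that .
    show "g differentiable (at x)" for x
      using P differentiable_at_real_polynomial_function unfolding garding_polynomial_def by blast
    show "strictly_concave_on \<Gamma> (\<lambda>x. ln (g x))" by (rule strictly_concave_log[OF edge])
    show "g (t *\<^sub>R x) = t powr real N * g x" if "t > 0" for x t
      using that by (simp add: g_homog powr_realpow)
    show "g x \<le> g (x + z)" if "x \<in> \<Gamma>" "z \<in> \<Gamma>" for x z by (rule monotone[OF that])
  qed
  show ?thesis
    by unfold_locales (use sublevel_compact open_polar_interior in auto)
qed

theorem theorem10p12:
  shows
    "(\<forall>(N :: real) (g :: 'v::euclidean_space \<Rightarrow> real) \<Gamma>.
        garding_like_pair N g \<Gamma> \<longrightarrow>
          open_polar (open_polar \<Gamma>) = to_bidual ` \<Gamma> \<and>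
          (\<forall>x\<in>\<Gamma>. dual_function (dual_function g \<Gamma>) (open_polar \<Gamma>) (to_bidual x) = g x)) \<and>
     (\<forall>(N :: nat) (g :: 'n::finite sym_matrix \<Rightarrow> real) \<Gamma>.
        garding_polynomial N g \<Gamma> \<and> edge \<Gamma> = {0} \<longrightarrow>
          (\<forall>x\<in>\<Gamma>. g x = dual_function (dual_function g \<Gamma>) (open_polar \<Gamma>) (to_bidual x)) \<and>
          to_bidual ` \<Gamma> = open_polar (open_polar \<Gamma>))"
proof (intro conjI allI impI)
  fix N :: real and g :: "'v \<Rightarrow> real" and \<Gamma>
  assume "garding_like_pair N g \<Gamma>"
  then interpret legendre_cone g \<Gamma> N by (rule garding_like_pair_legendre)
  show "open_polar (open_polar \<Gamma>) = to_bidual ` \<Gamma>" by (rule double_dual_cone)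
  show "\<forall>x\<in>\<Gamma>. dual_function (dual_function g \<Gamma>) (open_polar \<Gamma>) (to_bidual x) = g x"
    using double_dual_function by blast
next
  fix N :: nat and g :: "'n sym_matrix \<Rightarrow> real" and \<Gamma>
  assume "garding_polynomial N g \<Gamma> \<and> edge \<Gamma> = {0}"
  then interpret legendre_cone g \<Gamma> "real N" using garding_polynomial_legendre by blast
  show "\<forall>x\<in>\<Gamma>. g x = dual_function (dual_function g \<Gamma>) (open_polar \<Gamma>) (to_bidual x)"
    using double_dual_function by simp
  show "to_bidual ` \<Gamma> = open_polar (open_polar \<Gamma>)" using double_dual_cone by simp
qed

end
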